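(* Let $p$ be a prime number, let $K$ be a finite algebraic extension of the field $\mathbb{Q}_p$ of $p$-adic numbers, let $e$ be the ramification index of $K$ over $\mathbb{Q}_p$, let $f=[K:\mathbb{Q}_p]/e$, and let $\pi\in K$ be a uniformizer of $K$. For positive integers $m>n$, let \[\phi(z)=\frac{z^{p^f}-z}{\pi+z^{p^{mf}}-z^{p^{nf}}}\in K(z).\] Then the dynamical system $(\mathbb{P}^1(K),\phi)$ has empty Fatou set.
   Context: Let $|\cdot|_p$ denote the absolute value on $K$ extending the $p$-adic absolute value of $\mathbb{Q}_p$ (with $|p|_p=1/p$), and $v_p(x)=-\log_p|x|_p$ for $x\in K^*=K\setminus\{0\}$. The ramification index $e$ is the unique positive integer with $v_p(K^* )=\frac1e\mathbb{Z}$. A uniformizer is an element $\pi\in K$ with $v_p(\pi)=1/e$. The integer $f=[K:\mathbb{Q}_p]/e$ is the residue degree, so the residue field of $K$ has $p^f$ elements. The projective line $\mathbb{P}^1(K)$ is equipped with the spherical metric: for $P=[x_1,y_1]$, $Q=[x_2,y_2]\in\mathbb{P}^1(K)$, \[\rho(P,Q)=\frac{|x_1y_2-x_2y_1|_p}{\max\{|x_1|_p,|y_1|_p\}\,\max\{|x_2|_p,|y_2|_p\}}.\] A rational map $\phi\in K(z)$ induces a continuous map $\phi:\mathbb{P}^1(K)\to\mathbb{P}^1(K)$. The Fatou set of the system $(\mathbb{P}^1(K),\phi)$ is the set of points of $\mathbb{P}^1(K)$ having a neighborhood (in $\mathbb{P}^1(K)$) on which the family of iterates $\{\phi^k\}_{k\ge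 0}$ is equicontinuous with respect to $\rho$. *)

theory Defs
  imports
    "HOL-Analysis.Analysis"
    "HOL-Computational_Algebra.Computational_Algebra"
begin

definition absolute_value :: "('a::field \<Rightarrow> real) \<Rightarrow> bool" where
  "absolute_value v \<longleftrightarrow>
     (\<forall>x. 0 \<le> v x) \<and> (\<forall>x. v x = 0 \<longleftrightarrow> x = 0) \<and>
     (\<forall>x y. v (x * y) = v x * v y) \<and> (\<forall>x y. v (x + y) \<le> v x + v y)"

definition padic_abs :: "nat \<Rightarrow> rat \<Rightarrow> real" where
  "padic_abs p r = (if r = 0 then 0 else
     (let (a, b) = quotient_of r in
        real p powi (int (multiplicity (int p) b) - int (multiplicity (int p) a))))"

text \<open>
  There is no type depending on \<^term>\<open>p\<close>, so the field of \<^term>\<open>p\<close>-adic numbers is any field with an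
  absolute value that is a completion of the rationals with respect to \<^term>\<open>padic_abs p\<close>; such a
  completion is unique up to a unique isometric isomorphism.
\<close>
definition padic_numbers :: "nat \<Rightarrow> ('q::field_char_0 \<Rightarrow> real) \<Rightarrow> bool" where
  "padic_numbers p v \<longleftrightarrow>
     absolute_value v \<and>
     (\<forall>r. v (of_rat r) = padic_abs p r) \<and>
     (\<forall>x. \<forall>\<epsilon>>0. \<exists>r. v (x - of_rat r) < \<epsilon>) \<and>
     Metric_space.mcomplete UNIV (\<lambda>x y. v (x - y))"

text \<open>A field extension is given by its embedding \<^term>\<open>\<iota>\<close> of the base field.\<close>

definition ext_scale :: "('q::field \<Rightarrow> 'a::field) \<Rightarrow> 'q \<Rightarrow> 'a \<Rightarrow> 'a" where
  "ext_scale \<iota> c x = \<iota> c * x"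

definition finite_field_extension :: "('q::field \<Rightarrow> 'a::field) \<Rightarrow> bool" where
  "finite_field_extension \<iota> \<longleftrightarrow>
     \<iota> 1 = 1 \<and> (\<forall>x y. \<iota> (x + y) = \<iota> x + \<iota> y) \<and> (\<forall>x y. \<iota> (x * y) = \<iota> x * \<iota> y) \<and>
     (\<exists>B. finite B \<and> module.span (ext_scale \<iota>) B = UNIV)"

definition ext_degree :: "('q::field \<Rightarrow> 'a::field) \<Rightarrow> nat" where
  "ext_degree \<iota> = vector_space.dim (ext_scale \<iota>) (UNIV :: 'a set)"

definition padic_val :: "nat \<Rightarrow> ('a::field \<Rightarrow> real) \<Rightarrow> 'a \<Rightarrow> real" where
  "padic_val p v x = - log (real p) (v x)"

definition ramification_index :: "nat \<Rightarrow> ('a::field \<Rightarrow> real) \<Rightarrow> nat" where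
  "ramification_index p v =
     (THE e. e > 0 \<and> padic_val p v ` (UNIV - {0}) = range (\<lambda>k::int. of_int k / real e))"

definition uniformizer :: "nat \<Rightarrow> ('a::field \<Rightarrow> real) \<Rightarrow> 'a \<Rightarrow> bool" where
  "uniformizer p v \<pi> \<longleftrightarrow> \<pi> \<noteq> 0 \<and> padic_val p v \<pi> = 1 / real (ramification_index p v)"

definition proj_rel :: "'a::field \<times> 'a \<Rightarrow> 'a \<times> 'a \<Rightarrow> bool" where
  "proj_rel P Q \<longleftrightarrow> P \<noteq> (0, 0) \<and> Q \<noteq> (0, 0) \<and>
     (\<exists>c. c \<noteq> 0 \<and> fst Q = c * fst P \<and> snd Q = c * snd P)"

quotient_type (overloaded) 'a proj_line = "'a::field \<times> 'a" / partial: proj_rel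
proof (rule part_equivpI)
  show "\<exists>P::'a \<times> 'a. proj_rel P P"
    by (rule exI[of _ "(1, 0)"]) (auto simp: proj_rel_def intro: exI[of _ 1])
  show "symp (proj_rel :: 'a \<times> 'a \<Rightarrow> _)"
  proof (rule sympI)
    fix P Q :: "'a \<times> 'a"
    assume "proj_rel P Q"
    then obtain c where c: "P \<noteq> (0, 0)" "Q \<noteq> (0, 0)" "c \<noteq> 0" "fst Q = c * fst P" "snd Q = c * snd P"
      unfolding proj_rel_def by blast
    then show "proj_rel Q P"
      unfolding proj_rel_def by (intro conjI exI[of _ "inverse c"]) auto
  qed
  show "transp (proj_rel :: 'a \<times> 'a \<Rightarrow> _)"
  proof (rule transpI)
    fix P Q R :: "'a \<times> 'a"
    assume "proj_rel P Q" "proj_rel Q R"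
    then obtain c d where "P \<noteq> (0, 0)" "R \<noteq> (0, 0)" "c \<noteq> 0" "fst Q = c * fst P" "snd Q = c * snd P"
      "d \<noteq> 0" "fst R = d * fst Q" "snd R = d * snd Q"
      unfolding proj_rel_def by blast
    then show "proj_rel P R"
      unfolding proj_rel_def by (intro conjI exI[of _ "d * c"]) auto
  qed
qed

text \<open>The point $[x, y]$; only meaningful for $(x, y) \neq (0, 0)$.\<close>
definition proj_point :: "'a::field \<Rightarrow> 'a \<Rightarrow> 'a proj_line" where
  "proj_point x y = abs_proj_line (x, y)"

lemma proj_point_eq_iff:
  assumes "(x1, y1) \<noteq> (0, 0)" "(x2, y2) \<noteq> (0, 0)"
  shows "proj_point x1 y1 = proj_point x2 y2 \<longleftrightarrow> (\<exists>c. c \<noteq> 0 \<and> x2 = c * x1 \<and> y2 = c * y1)"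
proof -
  have refl: "proj_rel P P" if "P \<noteq> (0, 0)" for P :: "'a \<times> 'a"
    using that by (auto simp: proj_rel_def intro: exI[of _ 1])
  have "proj_point x1 y1 = proj_point x2 y2 \<longleftrightarrow> proj_rel (x1, y1) (x2, y2)"
    unfolding proj_point_def
    using Quotient3_proj_line[THEN Quotient3_rel, of "(x1, y1)" "(x2, y2)"] refl assms by simp
  also have "\<dots> \<longleftrightarrow> (\<exists>c. c \<noteq> 0 \<and> x2 = c * x1 \<and> y2 = c * y1)"
    using assms unfolding proj_rel_def by simp
  finally show ?thesis .
qed

lemma proj_point_cases:
  obtains x y where "(x, y) \<noteq> (0, 0)" "P = proj_point x y"
proof -
  have "proj_rel (rep_proj_line P) (rep_proj_line P)"
    using Quotient3_proj_line[THEN Quotient3_rep_reflp, of P] .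
  then have "rep_proj_line P \<noteq> (0, 0)"
    by (simp add: proj_rel_def)
  moreover have "P = proj_point (fst (rep_proj_line P)) (snd (rep_proj_line P))"
    using Quotient3_proj_line[THEN Quotient3_abs_rep, of P] by (simp add: proj_point_def)
  ultimately show ?thesis
    using that[of "fst (rep_proj_line P)" "snd (rep_proj_line P)"] by simp
qed

text \<open>
  For a multiplicative \<^term>\<open>v\<close> the value does not depend on the representatives, see
  \<open>spherical_dist_proj_point\<close> below.
\<close>
definition spherical_dist :: "('a::field \<Rightarrow> real) \<Rightarrow> 'a proj_line \<Rightarrow> 'a proj_line \<Rightarrow> real" where
  "spherical_dist v P Q =
     (let (x1, y1) = rep_proj_line P; (x2, y2) = rep_proj_line Q in
        v (x1 * y2 - x2 * y1) / (max (v x1) (v y1) * max (v x2) (v y2)))"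

lemma spherical_dist_proj_point:
  assumes v: "absolute_value v" and 1: "(x1, y1) \<noteq> (0, 0)" and 2: "(x2, y2) \<noteq> (0, 0)"
  shows "spherical_dist v (proj_point x1 y1) (proj_point x2 y2) =
           v (x1 * y2 - x2 * y1) / (max (v x1) (v y1) * max (v x2) (v y2))"
proof -
  have rep: "\<exists>c. c \<noteq> 0 \<and> rep_proj_line (proj_point x y) = (c * x, c * y)"
    if xy: "(x, y) \<noteq> (0, 0)" for x y :: 'a
  proof -
    let ?R = "rep_proj_line (proj_point x y)"
    have "proj_rel ?R ?R"
      using Quotient3_proj_line[THEN Quotient3_rep_reflp] .
    then have nz: "(fst ?R, snd ?R) \<noteq> (0, 0)"
      by (simp add: proj_rel_def)
    have "proj_point x y = proj_point (fst ?R) (snd ?R)"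
      using Quotient3_proj_line[THEN Quotient3_abs_rep, of "proj_point x y"]
      by (simp add: proj_point_def)
    then obtain c where "c \<noteq> 0" "fst ?R = c * x" "snd ?R = c * y"
      using proj_point_eq_iff[OF xy nz] by blast
    then show ?thesis
      by (metis prod.collapse)
  qed
  obtain c where c: "c \<noteq> 0" "rep_proj_line (proj_point x1 y1) = (c * x1, c * y1)"
    using rep[OF 1] by blast
  obtain d where d: "d \<noteq> 0" "rep_proj_line (proj_point x2 y2) = (d * x2, d * y2)"
    using rep[OF 2] by blast
  have mult: "v (x * y) = v x * v y" and nonneg: "0 \<le> v x" and zero: "v x = 0 \<longleftrightarrow> x = 0" for x y
    using v unfolding absolute_value_def by blast+
  have max: "max (v (a * x)) (v (a * y)) = v a * max (v x) (v y)" for a x y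
    using nonneg[of a] by (simp add: mult max_mult_distrib_left)
  have num: "c * x1 * (d * y2) - d * x2 * (c * y1) = (c * d) * (x1 * y2 - x2 * y1)"
    by (simp add: algebra_simps)
  have "v c \<noteq> 0" "v d \<noteq> 0"
    using c d zero by auto
  then show ?thesis
    unfolding spherical_dist_def c(2) d(2) by (simp add: num max) (simp add: mult)
qed

text \<open>$y^d F(x/y)$, the homogenization of \<^term>\<open>F\<close> in degree \<^term>\<open>d\<close> (for $d \geq \deg F$).\<close>
definition hom_eval :: "nat \<Rightarrow> 'a::field poly \<Rightarrow> 'a \<Rightarrow> 'a \<Rightarrow> 'a" where
  "hom_eval d F x y = (\<Sum>i\<le>d. coeff F i * x ^ i * y ^ (d - i))"

text \<open>
  The self-map of the projective line induced by a rational function $F/G$ in lowest terms: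
  $[x, y] \mapsto [F^*(x, y), G^*(x, y)]$ with both homogenizations in degree $\max(\deg F, \deg G)$;
  see \<open>rational_map_proj_point\<close> below for well-definedness.
\<close>
definition rational_map :: "'a::field poly fract \<Rightarrow> 'a proj_line \<Rightarrow> 'a proj_line" where
  "rational_map \<phi> P = (THE Q. \<exists>F G x y.
     G \<noteq> 0 \<and> coprime F G \<and> \<phi> = to_fract F / to_fract G \<and>
     (x, y) \<noteq> (0, 0) \<and> P = proj_point x y \<and>
     Q = proj_point (hom_eval (max (degree F) (degree G)) F x y)
                    (hom_eval (max (degree F) (degree G)) G x y))"

lemma poly_bezout:
  fixes F G :: "'a::field poly"
  assumes "coprime F G" and "G \<noteq> 0"
  obtains a b where "a * F + b * G = 1"
proof -
  define S where "S = {X. \<exists>a b. X = a * F + b * G}"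
  have SI: "a * F + b * G \<in> S" for a b
    unfolding S_def by blast
  have "G \<in> S"
    using SI[of 0 1] by simp
  then obtain D where D: "D \<in> S" "D \<noteq> 0"
    and min: "\<And>X. X \<in> S \<Longrightarrow> X \<noteq> 0 \<Longrightarrow> degree D \<le> degree X"
    using ex_has_least_nat[of "\<lambda>X. X \<in> S \<and> X \<noteq> 0" G degree] \<open>G \<noteq> 0\<close> by blast
  obtain a b where ab: "D = a * F + b * G"
    using D(1) unfolding S_def by blast
  have dvd: "D dvd X" if X: "X \<in> S" for X
  proof (rule ccontr)
    assume "\<not> D dvd X"
    then have nz: "X mod D \<noteq> 0"
      by (simp add: dvd_eq_mod_eq_0)
    obtain c d where "X = c * F + d * G"
      using X unfolding S_def by blast
    then have "X mod D = (c - (X div D) * a) * F + (d - (X div D) * b) * G"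
      by (simp add: minus_div_mult_eq_mod[symmetric] ab algebra_simps)
    then have "X mod D \<in> S"
      using SI by metis
    then show False
      using min[of "X mod D"] nz degree_mod_less[OF D(2), of X] by simp
  qed
  have "D dvd F" "D dvd G"
    using dvd SI[of 1 0] SI[of 0 1] by simp_all
  then have "D dvd 1"
    using assms(1) coprime_common_divisor by blast
  then obtain u where "1 = D * u" ..
  then have "(u * a) * F + (u * b) * G = 1"
    by (simp add: ab algebra_simps)
  then show ?thesis
    by (rule that)
qed

lemma hom_eval_eq:
  assumes "degree F \<le> d" and "y \<noteq> 0"
  shows "hom_eval d F x y = y ^ d * poly F (x / y)"
proof -
  have "poly F (x / y) = (\<Sum>i\<le>d. coeff F i * (x / y) ^ i)"
    using assms(1) by (auto simp: poly_altdef intro!: sum.mono_neutral_left intro: le_degree)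
  then show ?thesis
    using assms(2) unfolding hom_eval_def
    by (simp add: sum_distrib_left power_divide power_diff field_simps)
qed

lemma hom_eval_0_right: "hom_eval d F x 0 = coeff F d * x ^ d"
proof -
  have "hom_eval d F x 0 = (\<Sum>i\<in>{d}. coeff F i * x ^ i * 0 ^ (d - i))"
    unfolding hom_eval_def by (rule sum.mono_neutral_right) auto
  then show ?thesis
    by simp
qed

lemma hom_eval_scale: "hom_eval d F (c * x) (c * y) = c ^ d * hom_eval d F x y"
proof -
  have "coeff F i * (c * x) ^ i * (c * y) ^ (d - i) = c ^ d * (coeff F i * x ^ i * y ^ (d - i))"
    if "i \<le> d" for i
    using that power_add[of c i "d - i"] by (simp add: power_mult_distrib ac_simps)
  then show ?thesis
    unfolding hom_eval_def sum_distrib_left by (intro sum.cong) auto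
qed

lemma hom_eval_smult: "hom_eval d (smult u F) x y = u * hom_eval d F x y"
  unfolding hom_eval_def by (simp add: sum_distrib_left mult.assoc)

lemma hom_eval_nonzero:
  assumes "coprime F G" "G \<noteq> 0" "(x, y) \<noteq> (0, 0)" "d = max (degree F) (degree G)"
  shows "(hom_eval d F x y, hom_eval d G x y) \<noteq> (0, 0)"
proof
  assume 0: "(hom_eval d F x y, hom_eval d G x y) = (0, 0)"
  show False
  proof (cases "y = 0")
    case True
    then have "x \<noteq> 0" "coeff F d = 0" "coeff G d = 0"
      using assms(3) 0 by (auto simp: hom_eval_0_right)
    then show False
      using assms(2,4) by (auto simp: max_def split: if_splits)
  next
    case False
    then have "poly F (x / y) = 0" "poly G (x / y) = 0"
      using 0 assms(4) hom_eval_eq[of F d y x] hom_eval_eq[of G d y x] by auto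
    moreover obtain a b where "a * F + b * G = 1"
      using poly_bezout assms(1,2) .
    then have "poly (a * F + b * G) (x / y) = 1"
      by simp
    ultimately show False
      by simp
  qed
qed

lemma rational_map_proj_point:
  assumes "coprime F G" "G \<noteq> 0" "(x, y) \<noteq> (0, 0)" and d: "d = max (degree F) (degree G)"
  shows "rational_map (to_fract F / to_fract G) (proj_point x y) =
           proj_point (hom_eval d F x y) (hom_eval d G x y)"
  unfolding rational_map_def
proof (rule the_equality)
  fix Q
  assume "\<exists>F' G' x' y'. G' \<noteq> 0 \<and> coprime F' G' \<and>
    to_fract F / to_fract G = to_fract F' / to_fract G' \<and>
    (x', y') \<noteq> (0, 0) \<and> proj_point x y = proj_point x' y' \<and>
    Q = proj_point (hom_eval (max (degree F') (degree G')) F' x' y')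
                   (hom_eval (max (degree F') (degree G')) G' x' y')"
  then obtain F' G' x' y' where 1: "G' \<noteq> 0" "coprime F' G'"
      "to_fract F / to_fract G = to_fract F' / to_fract G'"
    and 2: "(x', y') \<noteq> (0, 0)" "proj_point x y = proj_point x' y'"
    and Q: "Q = proj_point (hom_eval (max (degree F') (degree G')) F' x' y')
                   (hom_eval (max (degree F') (degree G')) G' x' y')"
    by blast
  have "to_fract (F * G') = to_fract (F' * G)"
    using 1(1,3) assms(2) by (simp add: field_simps)
  then have cross: "F * G' = F' * G"
    by (simp only: to_fract_eq_iff)
  obtain a b where ab: "a * F + b * G = 1"
    using poly_bezout assms(1,2) .
  obtain a' b' where ab': "a' * F' + b' * G' = 1"
    using poly_bezout 1(2,1) .
  define w where "w = a * F' + b * G'"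
  have w: "F' = w * F" "G' = w * G"
  proof -
    have "w * F = F' * (a * F) + b * (F * G')"
      by (simp add: w_def algebra_simps)
    also have "\<dots> = F' * (a * F + b * G)"
      by (simp add: cross algebra_simps)
    finally show "F' = w * F"
      by (simp add: ab)
    have "w * G = a * (F' * G) + b * G * G'"
      by (simp add: w_def algebra_simps)
    also have "\<dots> = G' * (a * F + b * G)"
      by (simp add: cross[symmetric] algebra_simps)
    finally show "G' = w * G"
      by (simp add: ab)
  qed
  have "1 = w * (a' * F + b' * G)"
    using ab' by (simp add: w algebra_simps)
  then have "is_unit w"
    by (rule dvdI)
  then obtain u where u: "w = [:u:]" "u \<noteq> 0"
    unfolding is_unit_poly_iff by (metis dvd_0_left_iff zero_neq_one)
  have F': "F' = smult u F" "G' = smult u G"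
    by (simp_all add: w u)
  obtain c where c: "c \<noteq> 0" "x' = c * x" "y' = c * y"
    using 2 assms(3) proj_point_eq_iff by metis
  have "Q = proj_point ((u * c ^ d) * hom_eval d F x y) ((u * c ^ d) * hom_eval d G x y)"
    using u(2) by (simp add: Q F' c d hom_eval_smult hom_eval_scale ac_simps)
  moreover have nz: "(hom_eval d F x y, hom_eval d G x y) \<noteq> (0, 0)"
    using hom_eval_nonzero assms by blast
  moreover have "u * c ^ d \<noteq> 0"
    using u c by simp
  ultimately show "Q = proj_point (hom_eval d F x y) (hom_eval d G x y)"
    using proj_point_eq_iff[OF nz, of "(u * c ^ d) * hom_eval d F x y" "(u * c ^ d) * hom_eval d G x y"]
    by (metis mult_eq_0_iff prod.inject)
next
  show "\<exists>F' G' x' y'. G' \<noteq> 0 \<and> coprime F' G' \<and>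
    to_fract F / to_fract G = to_fract F' / to_fract G' \<and>
    (x', y') \<noteq> (0, 0) \<and> proj_point x y = proj_point x' y' \<and>
    proj_point (hom_eval d F x y) (hom_eval d G x y) =
      proj_point (hom_eval (max (degree F') (degree G')) F' x' y')
                 (hom_eval (max (degree F') (degree G')) G' x' y')"
    using assms by (intro exI[of _ F] exI[of _ G] exI[of _ x] exI[of _ y]) simp
qed

definition equicontinuous_on ::
  "('x \<Rightarrow> 'x \<Rightarrow> real) \<Rightarrow> 'x set \<Rightarrow> (nat \<Rightarrow> 'x \<Rightarrow> 'x) \<Rightarrow> bool" where
  "equicontinuous_on \<rho> U h \<longleftrightarrow>
     (\<forall>P\<in>U. \<forall>\<epsilon>>0. \<exists>\<delta>>0. \<forall>Q\<in>U. \<rho> P Q < \<delta> \<longrightarrow> (\<forall>k. \<rho> (h k P) (h k Q) < \<epsilon>))"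

definition Fatou_set :: "('x \<Rightarrow> 'x \<Rightarrow> real) \<Rightarrow> ('x \<Rightarrow> 'x) \<Rightarrow> 'x set" where
  "Fatou_set \<rho> g =
     {P. \<exists>U. (\<exists>r>0. {Q. \<rho> P Q < r} \<subseteq> U) \<and> equicontinuous_on \<rho> U (\<lambda>k. g ^^ k)}"

end

theory Submission
  imports Defs
begin

text \<open>
  The map expands: if $|x|, |y| \leq 1$ and $|x - y| < 1$, then $|\phi(x) - \phi(y)| = |x - y| / |\pi|$.
  Indeed, put $q = p^f$. On a residue disc $z \mapsto z^q$ is contracting, so the numerator $z^q - z$ changes
  exactly by $|x - y|$; the denominator has constant absolute value $|\pi|$ and changes by at most
  $|\pi| |x - y|$, which is of second order because $|z^q - z| \leq |\pi|$. Since $\phi$ maps the whole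
  projective line into the unit disc and has finite fibres, every point has arbitrarily close neighbours that
  some iterate moves apart.

  This needs that $q$ is the order of the residue field, that is, $[K : \mathbf{Q}_p] = e f$. A maximal
  family of integers of $K$ that is linearly independent modulo $p$ turns out to be a basis of $K$, so there
  are $p^{[K : \mathbf{Q}_p]}$ classes of integers modulo $p$. Finiteness gives discreteness of the value
  group, and counting the classes by $\pi$-adic digits instead gives $q^e$.
\<close>

section \<open>Nonarchimedean absolute values\<close>

lemma absolute_value_0: "absolute_value v \<Longrightarrow> v 0 = 0"
  and absolute_value_eq_0_iff: "absolute_value v \<Longrightarrow> v x = 0 \<longleftrightarrow> x = 0"
  and absolute_value_nonneg: "absolute_value v \<Longrightarrow> 0 \<le> v x"
  and absolute_value_mult: "absolute_value v \<Longrightarrow> v (x * y) = v x * v y"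
  and absolute_value_triangle: "absolute_value v \<Longrightarrow> v (x + y) \<le> v x + v y"
  unfolding absolute_value_def by blast+

lemma absolute_value_1: "absolute_value v \<Longrightarrow> v 1 = 1"
  using absolute_value_mult[of v 1 1] absolute_value_eq_0_iff[of v 1] by simp

lemma absolute_value_power: "absolute_value v \<Longrightarrow> v (x ^ n) = v x ^ n"
  by (induction n) (simp_all add: absolute_value_1 absolute_value_mult)

lemma absolute_value_sum_le: "absolute_value v \<Longrightarrow> v (\<Sum>i\<in>A. g i) \<le> (\<Sum>i\<in>A. v (g i))"
proof (induction A rule: infinite_finite_induct)
  case (insert x A)
  then show ?case
    using absolute_value_triangle[of v "g x" "sum g A"] by simp
qed (simp_all add: absolute_value_0)

text \<open>Expand $(x + y)^N$: its absolute value is at most $(N + 1) \max(|x|, |y|)^N$, and the factor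
  $N + 1$ is too small to compensate for a violation of the ultrametric inequality.\<close>
lemma absolute_value_ultrametric:
  fixes v :: "'a::field \<Rightarrow> real"
  assumes v: "absolute_value v" and nat: "\<And>n::nat. v (of_nat n) \<le> 1"
  shows "v (x + y) \<le> max (v x) (v y)"
proof (rule ccontr)
  define M where "M = max (v x) (v y)"
  assume "\<not> v (x + y) \<le> max (v x) (v y)"
  then have lt: "M < v (x + y)"
    unfolding M_def by (rule not_le_imp_less)
  have M0: "0 \<le> M"
    using absolute_value_nonneg[OF v, of x] by (simp add: M_def)
  have bound: "v (x + y) ^ N \<le> real (Suc N) * M ^ N" for N
  proof -
    have "v (x + y) ^ N = v (\<Sum>k\<le>N. of_nat (N choose k) * x ^ k * y ^ (N - k))"
      by (simp add: absolute_value_power[OF v, symmetric] binomial_ring)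
    also have "\<dots> \<le> (\<Sum>k\<le>N. v (of_nat (N choose k) * x ^ k * y ^ (N - k)))"
      by (rule absolute_value_sum_le[OF v])
    also have "\<dots> \<le> (\<Sum>k\<le>N. M ^ N)"
    proof (rule sum_mono)
      fix k assume "k \<in> {..N}"
      then have k: "k + (N - k) = N"
        by simp
      have "v (of_nat (N choose k) * x ^ k * y ^ (N - k))
          = v (of_nat (N choose k)) * (v x ^ k * v y ^ (N - k))"
        by (simp add: absolute_value_mult[OF v] absolute_value_power[OF v])
      also have "\<dots> \<le> 1 * (M ^ k * M ^ (N - k))"
        by (intro mult_mono power_mono nat) (auto simp: M_def absolute_value_nonneg[OF v] le_max_iff_disj)
      also have "\<dots> = M ^ N"
        using k by (simp flip: power_add)
      finally show "v (of_nat (N choose k) * x ^ k * y ^ (N - k)) \<le> M ^ N" .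
    qed
    finally show ?thesis
      by simp
  qed
  have pos: "M > 0"
    using bound[of 1] lt M0 by (cases "M = 0") auto
  define t where "t = v (x + y) / M - 1"
  have t: "t > 0"
    using lt pos by (simp add: t_def)
  have quot: "(1 + t) ^ N \<le> real (Suc N)" for N
    using bound[of N] pos by (simp add: t_def power_divide pos_divide_le_eq)
  have "(\<lambda>N. of_nat N / (1 + t) ^ N) \<longlonglongrightarrow> 0"
    by (rule lim_n_over_pown) (use t in simp)
  then have "eventually (\<lambda>N. real N / (1 + t) ^ N < 1 / 2) sequentially"
    by (rule order_tendstoD) simp
  then have "eventually (\<lambda>N. real N / (1 + t) ^ N < 1 / 2 \<and> N \<ge> 2) sequentially"
    using eventually_ge_at_top by eventually_elim simp
  then obtain N where N: "real N / (1 + t) ^ N < 1 / 2" "N \<ge> 2"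
    using eventually_happens by force
  have "real N * 2 < (1 + t) ^ N"
    using N(1) t by (simp add: divide_simps split: if_splits)
  with quot[of N] N(2) show False
    by simp
qed

locale nonarch_abs =
  fixes v :: "'a::field \<Rightarrow> real"
  assumes abs_val: "absolute_value v"
    and ultra: "v (x + y) \<le> max (v x) (v y)"
begin

lemmas v_0 [simp] = absolute_value_0[OF abs_val]
  and v_1 [simp] = absolute_value_1[OF abs_val]
  and v_eq_0_iff [simp] = absolute_value_eq_0_iff[OF abs_val]
  and v_nonneg [simp] = absolute_value_nonneg[OF abs_val]
  and v_mult = absolute_value_mult[OF abs_val]
  and v_power = absolute_value_power[OF abs_val]

lemma v_pos_iff [simp]: "0 < v x \<longleftrightarrow> x \<noteq> 0"
  using v_nonneg[of x] by (simp add: less_le)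

lemma v_minus [simp]: "v (- x) = v x"
proof -
  have "v (- 1) * v (- 1) = 1"
    by (simp flip: v_mult)
  then have "v (- 1) = 1"
    using v_nonneg[of "- 1"] by (simp add: square_eq_1_iff)
  then show ?thesis
    using v_mult[of "- 1" x] by simp
qed

lemma v_diff_commute: "v (x - y) = v (y - x)"
  using v_minus[of "x - y"] by simp

lemma v_add_le: "v x \<le> r \<Longrightarrow> v y \<le> r \<Longrightarrow> v (x + y) \<le> r"
  using ultra[of x y] by simp

lemma v_diff_le: "v x \<le> r \<Longrightarrow> v y \<le> r \<Longrightarrow> v (x - y) \<le> r"
  using v_add_le[of x r "- y"] by simp

lemma v_diff_trans: "v (x - y) \<le> r \<Longrightarrow> v (y - z) \<le> r \<Longrightarrow> v (x - z) \<le> r"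
  using v_add_le[of "x - y" r "y - z"] by simp

lemma v_sum_le: "0 \<le> r \<Longrightarrow> (\<And>i. i \<in> A \<Longrightarrow> v (g i) \<le> r) \<Longrightarrow> v (\<Sum>i\<in>A. g i) \<le> r"
  by (induction A rule: infinite_finite_induct) (simp_all add: v_add_le)

lemma v_prod: "v (\<Prod>i\<in>A. g i) = (\<Prod>i\<in>A. v (g i))"
  by (induction A rule: infinite_finite_induct) (simp_all add: v_mult)

lemma v_divide: "v (x / y) = v x / v y"
proof (cases "y = 0")
  case False
  then show ?thesis
    using v_mult[of "x / y" y] by (simp add: field_simps)
qed simp

text \<open>Since x = (x + y) - y, the ultrametric inequality bounds |x| by max(|x + y|, |y|), and
  |y| < |x| rules out the second entry.\<close>

lemma v_add_eq:
  assumes "v y < v x"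
  shows "v (x + y) = v x"
proof (rule antisym)
  show "v (x + y) \<le> v x"
    using assms by (intro v_add_le) auto
  show "v x \<le> v (x + y)"
    using ultra[of "x + y" "- y"] assms by auto
qed

lemma v_eqI: "v (x - y) < v y \<Longrightarrow> v x = v y"
  using v_add_eq[of "x - y" y] by simp

lemma v_mult_le: "v x \<le> 1 \<Longrightarrow> v y \<le> r \<Longrightarrow> v (x * y) \<le> r"
  using mult_mono[of "v x" 1 "v y" r] by (simp add: v_mult)

lemma v_power_le_1: "v x \<le> 1 \<Longrightarrow> v (x ^ n) \<le> 1"
  by (simp add: v_power power_le_one)

lemma v_of_nat_le_1: "v (of_nat n) \<le> 1"
  by (induction n) (simp_all add: v_add_le)

lemma v_of_int_le_1: "v (of_int k) \<le> 1"
  by (cases k rule: int_cases2) (simp_all add: v_of_nat_le_1)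

end

section \<open>Residue systems\<close>

context nonarch_abs
begin

text \<open>Stands for the quotient of the ring of integers by a ball around 0. With the radius as a
  real parameter, one notion covers reduction modulo \<pi>, modulo \<pi>^k and modulo p.\<close>

definition residue_system :: "real \<Rightarrow> 'a set \<Rightarrow> bool" where
  "residue_system \<delta> R \<longleftrightarrow>
     finite R \<and> R \<subseteq> {x. v x \<le> 1} \<and> (\<forall>x. v x \<le> 1 \<longrightarrow> (\<exists>!r. r \<in> R \<and> v (x - r) \<le> \<delta>))"

lemma residue_system_obtain:
  assumes "residue_system \<delta> R" "v x \<le> 1"
  obtains r where "r \<in> R" "v (x - r) \<le> \<delta>"
  using assms unfolding residue_system_def by blast

lemma residue_system_eq:
  assumes "residue_system \<delta> R" "0 \<le> \<delta>" "r \<in> R" "s \<in> R" "v (r - s) \<le> \<delta>"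
  shows "r = s"
proof -
  have "v r \<le> 1"
    using assms(1,3) unfolding residue_system_def by blast
  then have "\<exists>!t. t \<in> R \<and> v (r - t) \<le> \<delta>"
    using assms(1) unfolding residue_system_def by blast
  moreover have "v (r - r) \<le> \<delta>"
    using assms(2) by simp
  ultimately show ?thesis
    using assms(3-5) by blast
qed

lemma residue_systemI:
  assumes "finite R" "\<And>r. r \<in> R \<Longrightarrow> v r \<le> 1"
    and "\<And>x. v x \<le> 1 \<Longrightarrow> \<exists>r\<in>R. v (x - r) \<le> \<delta>"
    and "\<And>r s. r \<in> R \<Longrightarrow> s \<in> R \<Longrightarrow> v (r - s) \<le> \<delta> \<Longrightarrow> r = s"
  shows "residue_system \<delta> R"
  unfolding residue_system_def
proof (intro conjI allI impI)
  fix x assume "v x \<le> 1"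
  then obtain r where r: "r \<in> R" "v (x - r) \<le> \<delta>"
    using assms(3) by blast
  show "\<exists>!r. r \<in> R \<and> v (x - r) \<le> \<delta>"
  proof (rule ex1I[of _ r])
    fix s assume s: "s \<in> R \<and> v (x - s) \<le> \<delta>"
    then have "v (s - r) \<le> \<delta>"
      using v_diff_trans[of s x \<delta> r] r(2) by (simp add: v_diff_commute)
    then show "s = r"
      using assms(4) s r(1) by blast
  qed (use r in simp)
qed (use assms in auto)

text \<open>Sending each \<open>r\<close> to a \<delta>-close element of \<open>S\<close> is
  injective: two preimages of one element are congruent by the ultrametric inequality.\<close>

lemma residue_system_card_le:
  assumes R: "residue_system \<delta> R" and S: "residue_system \<delta> S" and "0 \<le> \<delta>"
  shows "card R \<le> card S"
proof -
  have "\<forall>r\<in>R. \<exists>s. s \<in> S \<and> v (r - s) \<le> \<delta>"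
    using R S unfolding residue_system_def by blast
  then obtain h where h: "\<And>r. r \<in> R \<Longrightarrow> h r \<in> S \<and> v (r - h r) \<le> \<delta>"
    by metis
  have "inj_on h R"
  proof (rule inj_onI)
    fix r s assume rs: "r \<in> R" "s \<in> R" "h r = h s"
    then have "v (r - s) \<le> \<delta>"
      using h[of r] h[of s] v_diff_trans[of r "h r" \<delta> s] by (simp add: v_diff_commute)
    then show "r = s"
      using residue_system_eq[OF R \<open>0 \<le> \<delta>\<close>] rs by blast
  qed
  moreover have "finite S"
    using S unfolding residue_system_def by blast
  ultimately show ?thesis
    using h by (intro card_inj_on_le[of h]) auto
qed

lemma residue_system_card_eq:
  "residue_system \<delta> R \<Longrightarrow> residue_system \<delta> S \<Longrightarrow> 0 \<le> \<delta> \<Longrightarrow> card R = card S"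
  by (intro antisym residue_system_card_le)

text \<open>\<open>T\<close> may hit a class repeatedly; replacing each element by a choice that
  depends only on its class removes the repetitions.\<close>

lemma residue_system_exists:
  assumes T: "finite T" "\<And>x. v x \<le> 1 \<Longrightarrow> \<exists>t\<in>T. v (x - t) \<le> \<delta>" and T1: "\<And>t. t \<in> T \<Longrightarrow> v t \<le> 1"
    and \<delta>: "0 \<le> \<delta>"
  obtains R where "residue_system \<delta> R"
proof -
  define c where "c x = (SOME y. v y \<le> 1 \<and> v (x - y) \<le> \<delta>)" for x
  have c: "v (c x) \<le> 1 \<and> v (x - c x) \<le> \<delta>" if "v x \<le> 1" for x
    unfolding c_def by (rule someI[of _ x]) (use that \<delta> in simp)
  \<comment> \<open>For congruent \<open>x\<close> and \<open>y\<close> the predicates behind the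
    two choices coincide, so the choice operator returns the same element.\<close>
  have c_cong: "c x = c y" if "v (x - y) \<le> \<delta>" for x y
  proof -
    have "v (x - z) \<le> \<delta> \<longleftrightarrow> v (y - z) \<le> \<delta>" for z
      using that v_diff_trans[of x y \<delta> z] v_diff_trans[of y x \<delta> z] by (auto simp: v_diff_commute)
    then show ?thesis
      by (simp add: c_def)
  qed
  have "residue_system \<delta> (c ` T)"
  proof (rule residue_systemI)
    fix x assume x: "v x \<le> 1"
    then obtain t where t: "t \<in> T" "v (x - t) \<le> \<delta>"
      using T(2) by blast
    then show "\<exists>r\<in>c ` T. v (x - r) \<le> \<delta>"
      using c[OF x] c_cong by (intro bexI[of _ "c x"]) auto
  next
    fix r s assume "r \<in> c ` T" "s \<in> c ` T" and rs: "v (r - s) \<le> \<delta>"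
    then obtain t u where tu: "t \<in> T" "u \<in> T" "r = c t" "s = c u"
      by blast
    have "v (t - c u) \<le> \<delta>"
      using c T1 tu rs by (blast intro: v_diff_trans)
    then have "v (t - u) \<le> \<delta>"
      using c[OF T1[OF tu(2)]] v_diff_trans[of t "c u" \<delta> u] by (simp add: v_diff_commute)
    then show "r = s"
      using c_cong tu by simp
  qed (use T(1) T1 c in auto)
  then show ?thesis
    by (rule that)
qed

text \<open>Digit expansions $r_0 + r_1 \varpi + \dots + r_{k-1} \varpi^{k-1}$ represent the classes
  modulo $\varpi^k$.\<close>
lemma residue_system_power:
  assumes R: "residue_system (v \<pi>) R" and \<pi>: "\<pi> \<noteq> 0" "v \<pi> \<le> 1"
  shows "\<exists>S. residue_system (v \<pi> ^ k) S \<and> card S = card R ^ k"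
proof (induction k)
  case 0
  have "residue_system 1 {0}"
    by (rule residue_systemI) auto
  then show ?case
    by force
next
  case (Suc k)
  then obtain S where S: "residue_system (v \<pi> ^ k) S" "card S = card R ^ k"
    by blast
  have fin: "finite R" "finite S" and R1: "\<And>r. r \<in> R \<Longrightarrow> v r \<le> 1" and S1: "\<And>s. s \<in> S \<Longrightarrow> v s \<le> 1"
    using R S(1) unfolding residue_system_def by blast+
  define h where "h = (\<lambda>(r, s). r + \<pi> * s)"
  have small: "v (\<pi> * s) \<le> v \<pi>" if "v s \<le> 1" for s
    using v_mult_le[OF that, of \<pi>] by (simp add: mult.commute)
  have h_eq: "x = y" if xy: "x \<in> R \<times> S" "y \<in> R \<times> S" and le: "v (h x - h y) \<le> v \<pi> ^ Suc k" for x y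
  proof -
    obtain r s r' s' where rs: "x = (r, s)" "y = (r', s')" "r \<in> R" "s \<in> S" "r' \<in> R" "s' \<in> S"
      using xy by blast
    \<comment> \<open>Weakening the congruence to one modulo \<pi> compares the leading digits; once
      these agree, dividing by \<pi> leaves a congruence modulo \<pi>^k between the tails.\<close>
    have "v \<pi> ^ Suc k \<le> v \<pi>"
      using \<pi>(2) power_decreasing[of 1 "Suc k" "v \<pi>"] by simp
    then have "v (h x - h y) \<le> v \<pi>"
      using le by linarith
    moreover have "v (\<pi> * (s - s')) \<le> v \<pi>"
      using S1 rs by (intro small v_diff_le)
    ultimately have "v ((h x - h y) - \<pi> * (s - s')) \<le> v \<pi>"
      by (rule v_diff_le)
    also have "(h x - h y) - \<pi> * (s - s') = r - r'"
      by (simp add: h_def rs algebra_simps)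
    finally have r: "r = r'"
      using residue_system_eq[OF R] rs by simp
    have "h x - h y = \<pi> * (s - s')"
      by (simp add: h_def rs r algebra_simps)
    then have "v (s - s') \<le> v \<pi> ^ k"
      using le \<pi>(1) by (simp add: v_mult)
    then have "s = s'"
      using residue_system_eq[OF S(1)] rs by simp
    with r rs show ?thesis
      by simp
  qed
  have "residue_system (v \<pi> ^ Suc k) (h ` (R \<times> S))"
  proof (rule residue_systemI)
    fix t assume "t \<in> h ` (R \<times> S)"
    then obtain r s where "r \<in> R" "s \<in> S" "t = r + \<pi> * s"
      by (auto simp: h_def)
    then show "v t \<le> 1"
      using R1 S1 \<pi>(2) by (auto intro!: v_add_le v_mult_le)
  next
    fix x assume "v x \<le> 1"
    then obtain r where r: "r \<in> R" "v (x - r) \<le> v \<pi>"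
      using residue_system_obtain[OF R] by blast
    then have "v ((x - r) / \<pi>) \<le> 1"
      using \<pi>(1) by (simp add: v_divide)
    then obtain s where s: "s \<in> S" "v ((x - r) / \<pi> - s) \<le> v \<pi> ^ k"
      using residue_system_obtain[OF S(1)] by blast
    have "v (\<pi> * ((x - r) / \<pi> - s)) \<le> v \<pi> ^ Suc k"
      using s(2) by (simp add: v_mult mult_left_mono)
    also have "\<pi> * ((x - r) / \<pi> - s) = x - h (r, s)"
      using \<pi>(1) by (simp add: h_def field_simps)
    finally show "\<exists>t\<in>h ` (R \<times> S). v (x - t) \<le> v \<pi> ^ Suc k"
      using r(1) s(1) by (intro bexI[of _ "h (r, s)"]) auto
  next
    fix x y assume "x \<in> h ` (R \<times> S)" "y \<in> h ` (R \<times> S)" "v (x - y) \<le> v \<pi> ^ Suc k"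
    then show "x = y"
      using h_eq by blast
  qed (use fin in auto)
  moreover have "inj_on h (R \<times> S)"
    by (rule inj_onI) (use h_eq in simp)
  then have "card (h ` (R \<times> S)) = card R ^ Suc k"
    by (simp add: card_image card_cartesian_product S(2))
  ultimately show ?case
    by blast
qed

section \<open>Congruences between products and the q-power map on residues\<close>

text \<open>Replace one factor at a time: with A and B the products over \<open>I\<close>, a A - b B
  = a (A - B) + B (a - b).\<close>

lemma v_prod_diff:
  assumes "\<And>i. i \<in> I \<Longrightarrow> v (a i) \<le> 1" "\<And>i. i \<in> I \<Longrightarrow> v (b i) \<le> 1"
    and "\<And>i. i \<in> I \<Longrightarrow> v (a i - b i) \<le> \<delta>" and "0 \<le> \<delta>"
  shows "v (prod a I - prod b I) \<le> \<delta>"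
  using assms
proof (induction I rule: infinite_finite_induct)
  case (insert i I)
  have "v (prod b I) \<le> 1"
    using insert.prems by (simp add: v_prod prod_le_1)
  then have "v (prod b I * (a i - b i)) \<le> \<delta>"
    using insert.prems by (intro v_mult_le) simp_all
  moreover have "v (a i * (prod a I - prod b I)) \<le> \<delta>"
    using insert by (intro v_mult_le) simp_all
  ultimately have "v (a i * (prod a I - prod b I) + prod b I * (a i - b i)) \<le> \<delta>"
    by (rule v_add_le[rotated])
  also have "a i * (prod a I - prod b I) + prod b I * (a i - b i) = prod a (insert i I) - prod b (insert i I)"
    using insert.hyps by (simp add: algebra_simps)
  finally show ?case .
qed simp_all

text \<open>Multiplication by a unit permutes the nonzero residues; compare their products.\<close>
lemma v_power_card_residues:
  assumes R: "residue_system (v \<pi>) R" and max: "\<And>x. v x < 1 \<Longrightarrow> v x \<le> v \<pi>"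
    and \<pi>: "v \<pi> < 1" and x: "v x \<le> 1"
  shows "v (x ^ card R - x) \<le> v \<pi>"
proof -
  have fin: "finite R" and R1: "\<And>r. r \<in> R \<Longrightarrow> v r \<le> 1"
    using R unfolding residue_system_def by blast+
  \<comment> \<open>\<open>r0\<close> represents the zero class; as |\<pi>| is the largest value
    below 1, all other representatives are units.\<close>
  obtain r0 where r0: "r0 \<in> R" "v r0 \<le> v \<pi>"
    using residue_system_obtain[OF R, of 0] by auto
  define U where "U = R - {r0}"
  have U: "v r = 1" if "r \<in> U" for r
  proof (rule ccontr)
    assume "v r \<noteq> 1"
    then have "v (r - r0) \<le> v \<pi>"
      using that R1 r0 max[of r] by (intro v_diff_le) (force simp: U_def)+
    then show False
      using residue_system_eq[OF R] that r0 by (auto simp: U_def)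
  qed
  have card: "card R = Suc (card U)"
    unfolding U_def using fin r0(1) by (metis card_Suc_Diff1)
  show ?thesis
  proof (cases "v x < 1")
    case True
    \<comment> \<open>For a nonunit x, both x and its power are divisible by \<pi>. Splitting off
      one factor x also covers \<open>card U = 0\<close>.\<close>
    then have "v (x ^ card U * x) \<le> v \<pi>"
      using max by (intro v_mult_le v_power_le_1) auto
    then show ?thesis
      using max[OF True] by (intro v_diff_le) (simp_all add: card mult.commute)
  next
    case False
    then have x1: "v x = 1"
      using x by simp
    have "\<exists>s\<in>U. v (x * r - s) \<le> v \<pi>" if r: "r \<in> U" for r
    proof -
      obtain s where s: "s \<in> R" "v (x * r - s) \<le> v \<pi>"
        using residue_system_obtain[OF R, of "x * r"] U[OF r] x1 by (auto simp: v_mult)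
      then have "v (s - x * r) < v (x * r)"
        using U[OF r] x1 \<pi> by (simp add: v_diff_commute v_mult)
      then have "v s = 1"
        using v_eqI[of s "x * r"] U[OF r] x1 by (simp add: v_mult)
      then show ?thesis
        using s r0(2) \<pi> by (auto simp: U_def)
    qed
    then obtain \<sigma> where \<sigma>: "\<And>r. r \<in> U \<Longrightarrow> \<sigma> r \<in> U \<and> v (x * r - \<sigma> r) \<le> v \<pi>"
      by metis
    have "inj_on \<sigma> U"
    proof (rule inj_onI)
      fix r s assume rs: "r \<in> U" "s \<in> U" "\<sigma> r = \<sigma> s"
      then have "v (x * r - x * s) \<le> v \<pi>"
        using \<sigma>[of r] \<sigma>[of s] v_diff_trans[of "x * r" "\<sigma> r" "v \<pi>" "x * s"] by (simp add: v_diff_commute)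
      then have "v (r - s) \<le> v \<pi>"
        using x1 by (simp add: v_mult flip: right_diff_distrib)
      then show "r = s"
        using residue_system_eq[OF R] rs by (simp add: U_def)
    qed
    moreover have "\<sigma> ` U \<subseteq> U"
      using \<sigma> by blast
    ultimately have "\<sigma> ` U = U"
      using fin by (intro endo_inj_surj) (simp_all add: U_def)
    then have perm: "prod \<sigma> U = \<Prod>U"
      using \<open>inj_on \<sigma> U\<close> prod.reindex[of \<sigma> U "\<lambda>r. r"] by simp
    \<comment> \<open>The product over \<open>U\<close> is a unit and cancels, which leaves x^(card
      U) congruent to 1.\<close>
    have "v ((\<Prod>r\<in>U. x * r) - prod \<sigma> U) \<le> v \<pi>"
      using \<sigma> U x1 by (intro v_prod_diff) (simp_all add: v_mult)
    also have "(\<Prod>r\<in>U. x * r) - prod \<sigma> U = (x ^ card U - 1) * \<Prod>U"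
      by (simp add: perm prod.distrib left_diff_distrib)
    also have "v \<dots> = v (x ^ card U - 1)"
      using U by (simp add: v_mult v_prod)
    finally have "v (x * (x ^ card U - 1)) \<le> v \<pi>"
      by (intro v_mult_le x)
    then show ?thesis
      by (simp add: card right_diff_distrib)
  qed
qed

section \<open>Discrete value groups\<close>

text \<open>Choose k with |\<pi>|^(k+1) < |x| \<le> |\<pi>|^k. Then |x / \<pi>^k| lies in (|\<pi>|,
  1], and maximality of |\<pi>| leaves only 1.\<close>

lemma value_group_generated:
  assumes \<pi>: "\<pi> \<noteq> 0" "v \<pi> < 1" and max: "\<And>x. v x < 1 \<Longrightarrow> v x \<le> v \<pi>"
    and x: "x \<noteq> 0" "v x \<le> 1"
  shows "\<exists>k. v x = v \<pi> ^ k"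
proof -
  obtain N where N: "v \<pi> ^ N < v x"
    using real_arch_pow_inv[OF _ \<pi>(2)] x(1) by (metis v_pos_iff)
  define k where "k = (LEAST k. v \<pi> ^ Suc k < v x)"
  have "v \<pi> ^ Suc N \<le> v \<pi> ^ N"
    using \<pi>(2) by (intro power_decreasing) simp_all
  then have "v \<pi> ^ Suc N < v x"
    using N by linarith
  then have k1: "v \<pi> ^ Suc k < v x"
    unfolding k_def by (rule LeastI)
  have k2: "v x \<le> v \<pi> ^ k"
  proof (cases k)
    case (Suc j)
    then have "\<not> v \<pi> ^ Suc j < v x"
      using not_less_Least[of j "\<lambda>k. v \<pi> ^ Suc k < v x"] by (simp add: k_def)
    then show ?thesis
      by (simp add: Suc)
  qed (use x in simp)
  have pos: "0 < v \<pi> ^ k"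
    using \<pi>(1) by simp
  have "\<not> v (x / \<pi> ^ k) \<le> v \<pi>"
    using k1 pos by (simp add: v_divide v_power pos_divide_le_eq)
  moreover have "v (x / \<pi> ^ k) \<le> 1"
    using k2 pos by (simp add: v_divide v_power pos_divide_le_eq)
  ultimately have "v (x / \<pi> ^ k) = 1"
    using max[of "x / \<pi> ^ k"] by linarith
  then have "v x = v \<pi> ^ k"
    using pos by (simp add: v_divide v_power)
  then show ?thesis ..
qed

lemma value_group_generated_int:
  assumes \<pi>: "\<pi> \<noteq> 0" "v \<pi> < 1" and max: "\<And>x. v x < 1 \<Longrightarrow> v x \<le> v \<pi>" and x: "x \<noteq> 0"
  shows "\<exists>k::int. v x = v \<pi> powi k"
proof (cases "v x \<le> 1")
  case True
  then obtain k where "v x = v \<pi> ^ k"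
    using value_group_generated assms by blast
  then show ?thesis
    by (intro exI[of _ "int k"]) simp
next
  case False
  then have "v (1 / x) \<le> 1"
    by (simp add: v_divide divide_le_eq_1)
  then obtain k where k: "v (1 / x) = v \<pi> ^ k"
    using value_group_generated[of \<pi> "1 / x"] assms by auto
  have "v x = inverse (v (1 / x))"
    by (simp add: v_divide)
  then have "v x = inverse (v \<pi> ^ k)"
    by (simp only: k)
  then show ?thesis
    by (intro exI[of _ "- int k"]) (simp add: power_int_minus)
qed

text \<open>By the ultrametric inequality every value strictly between |\<kappa>| and 1 is taken on
  the finite set \<open>T\<close>, so a largest value below 1 exists.\<close>

lemma max_value_exists:
  assumes T: "finite T" "\<And>x. v x \<le> 1 \<Longrightarrow> \<exists>t\<in>T. v (x - t) \<le> v \<kappa>" and \<kappa>: "\<kappa> \<noteq> 0" "v \<kappa> < 1"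
  obtains \<pi> where "\<pi> \<noteq> 0" "v \<pi> < 1" "\<And>x. v x < 1 \<Longrightarrow> v x \<le> v \<pi>"
proof -
  define W where "W = insert \<kappa> {t\<in>T. t \<noteq> 0 \<and> v t < 1}"
  have W: "finite W" "\<And>w. w \<in> W \<Longrightarrow> w \<noteq> 0 \<and> v w < 1" "\<kappa> \<in> W"
    using T(1) \<kappa> by (auto simp: W_def)
  have "Max (v ` W) \<in> v ` W"
    using W by (intro Max_in) auto
  then obtain \<pi> where \<pi>: "\<pi> \<in> W" "v \<pi> = Max (v ` W)"
    by force
  have max: "v w \<le> v \<pi>" if "w \<in> W" for w
    using that W(1) by (simp add: \<pi>(2))
  have "v x \<le> v \<pi>" if x: "v x < 1" for x
  proof (cases "v x \<le> v \<kappa>")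
    case True
    then show ?thesis
      using max[OF W(3)] by linarith
  next
    case False
    then have x0: "0 < v x"
      using v_nonneg[of \<kappa>] by linarith
    obtain t where t: "t \<in> T" "v (x - t) \<le> v \<kappa>"
      using T(2) x by force
    then have "v (t - x) < v x"
      using False by (simp add: v_diff_commute)
    then have "v t = v x"
      by (rule v_eqI)
    moreover from this have "t \<in> W"
      using x x0 t(1) by (auto simp: W_def)
    ultimately show ?thesis
      using max by force
  qed
  then show ?thesis
    using that W(2)[OF \<pi>(1)] by blast
qed

end

section \<open>The $p$-adic absolute value\<close>

lemma padic_abs_of_int:
  "padic_abs p (of_int a) = (if a = 0 then 0 else (1 / real p) ^ multiplicity (int p) a)"
  by (simp add: padic_abs_def power_int_minus power_one_over inverse_eq_divide)

lemma padic_abs_unit: "\<not> int p dvd b \<Longrightarrow> padic_abs p (of_int b) = 1"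
  by (auto simp: padic_abs_of_int not_dvd_imp_multiplicity_0)

lemma padic_abs_of_int_le_1: "prime p \<Longrightarrow> padic_abs p (of_int a) \<le> 1"
  by (auto simp: padic_abs_of_int intro!: power_le_one simp: prime_gt_0_nat Suc_leI)

lemma padic_abs_p: "prime p \<Longrightarrow> padic_abs p (of_nat p) = 1 / real p"
  using padic_abs_of_int[of p "int p"] by (simp add: multiplicity_self prime_gt_0_nat)

text \<open>In lowest terms, a prime p dividing \<open>b\<close> would not divide \<open>a\<close>,
  so |r| would be a positive power of p.\<close>

lemma not_dvd_denominator:
  assumes p: "prime p" and r: "padic_abs p r \<le> 1" "quotient_of r = (a, b)"
  shows "\<not> int p dvd b"
proof
  assume dvd: "int p dvd b"
  have "coprime a b" "b > 0"
    using r(2) by (auto intro: quotient_of_coprime quotient_of_denom_pos)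
  then have a: "\<not> int p dvd a"
    using dvd p by (metis coprime_common_divisor not_prime_unit prime_nat_int_transfer)
  then have "r \<noteq> 0"
    using r(2) by auto
  moreover have "multiplicity (int p) a = 0"
    using a by (rule not_dvd_imp_multiplicity_0)
  ultimately have "padic_abs p r = real p ^ multiplicity (int p) b"
    using r(2) by (simp add: padic_abs_def)
  moreover have "0 < multiplicity (int p) b"
    using dvd p \<open>b > 0\<close> by (simp add: prime_multiplicity_gt_zero_iff)
  then have "1 < real p ^ multiplicity (int p) b"
    using prime_gt_1_nat[OF p] by (intro one_less_power) simp_all
  ultimately show False
    using r(1) by simp
qed

lemma int_inverse_mod_prime:
  assumes "prime p" "\<not> int p dvd b"
  obtains c where "int p dvd b * c - 1"
proof -
  have "coprime (int p) b"
    using assms by (intro prime_imp_coprime) simp_all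
  then have "gcd (int p) b = 1"
    by simp
  moreover obtain u w where "u * int p + w * b = gcd (int p) b"
    using bezout_int by blast
  ultimately have "b * w - 1 = int p * (- u)"
    by (simp add: algebra_simps)
  then show ?thesis
    using that by (metis dvd_triv_left)
qed

section \<open>Finite extensions of the $p$-adic numbers\<close>

locale padic_extension =
  fixes p :: nat and absQ :: "'q::field_char_0 \<Rightarrow> real" and \<iota> :: "'q \<Rightarrow> 'a::field"
    and absK :: "'a \<Rightarrow> real"
  assumes prime_p: "prime p" and padic: "padic_numbers p absQ"
    and ext: "finite_field_extension \<iota>"
    and absK: "absolute_value absK" and absK_iota: "absK (\<iota> x) = absQ x"
begin

lemma iota_1 [simp]: "\<iota> 1 = 1"
  and iota_add: "\<iota> (x + y) = \<iota> x + \<iota> y"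
  and iota_mult: "\<iota> (x * y) = \<iota> x * \<iota> y"
  using ext unfolding finite_field_extension_def by blast+

lemma iota_0 [simp]: "\<iota> 0 = 0"
  using iota_add[of 0 0] by (metis add.right_neutral add_left_cancel)

lemma iota_diff: "\<iota> (x - y) = \<iota> x - \<iota> y"
  using iota_add[of "x - y" y] by simp

lemma iota_of_nat [simp]: "\<iota> (of_nat k) = of_nat k"
  by (induction k) (simp_all add: iota_add)

lemma iota_of_int [simp]: "\<iota> (of_int k) = of_int k"
  using iota_diff[of 0] by (cases k rule: int_cases2) simp_all

lemma iota_power: "\<iota> (x ^ k) = \<iota> x ^ k"
  by (induction k) (simp_all add: iota_mult)

lemma absQ_of_rat: "absQ (of_rat r) = padic_abs p r"
  and absQ: "absolute_value absQ"
  and absQ_dense: "0 < \<epsilon> \<Longrightarrow> \<exists>r. absQ (x - of_rat r) < \<epsilon>"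
  using padic unfolding padic_numbers_def by blast+

lemma absQ_of_int: "absQ (of_int k) = padic_abs p (of_int k)"
  using absQ_of_rat[of "of_int k"] by simp

lemma absK_of_int: "absK (of_int k) = padic_abs p (of_int k)"
  using absK_iota[of "of_int k"] absQ_of_int by simp

sublocale Q: nonarch_abs absQ
proof
  show "absQ (x + y) \<le> max (absQ x) (absQ y)" for x y
  proof (rule absolute_value_ultrametric[OF absQ])
    show "absQ (of_nat n) \<le> 1" for n
      using absQ_of_int[of "int n"] padic_abs_of_int_le_1[OF prime_p, of "int n"] by simp
  qed
qed (fact absQ)

sublocale K: nonarch_abs absK
proof
  show "absK (x + y) \<le> max (absK x) (absK y)" for x y
  proof (rule absolute_value_ultrametric[OF absK])
    show "absK (of_nat n) \<le> 1" for n
      using absK_of_int[of "int n"] padic_abs_of_int_le_1[OF prime_p, of "int n"] by simp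
  qed
qed (fact absK)

sublocale V: vector_space "ext_scale \<iota>"
  by unfold_locales (simp_all add: ext_scale_def iota_add iota_mult algebra_simps)

lemma p_gt_1: "1 < real p"
  using prime_gt_1_nat[OF prime_p] by simp

lemma absK_p: "absK (of_nat p) = 1 / real p"
  using absK_of_int[of "int p"] padic_abs_p[OF prime_p] by simp

lemma absQ_p: "absQ (of_nat p) = 1 / real p"
  using absQ_of_int[of "int p"] padic_abs_p[OF prime_p] by simp

lemma p_nonzero [simp]: "(of_nat p :: 'a) \<noteq> 0"
  using K.v_eq_0_iff[of "of_nat p"] absK_p p_gt_1 by simp

lemma absK_dvd:
  assumes "int p dvd a"
  shows "absK (of_int a) \<le> 1 / real p"
proof -
  obtain k where k: "a = int p * k"
    using assms ..
  have "absK (of_int k * of_nat p) \<le> 1 / real p"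
    by (intro K.v_mult_le K.v_of_int_le_1) (simp add: absK_p)
  then show ?thesis
    by (simp add: k mult.commute)
qed

lemma absQ_dvd: "int p dvd a \<Longrightarrow> absQ (of_int a) \<le> 1 / real p"
  using absK_dvd by (simp add: absK_of_int absQ_of_int)

text \<open>Density gives a rational a/b near c; it is integral, so p does not divide b. Replacing
  1/b by an integer inverse d of b modulo p changes a/b by a (1 - b d) / b, of absolute value at
  most 1/p.\<close>

lemma approx_by_int:
  assumes "absQ c \<le> 1"
  shows "\<exists>a::int. absQ (c - of_int a) \<le> 1 / real p"
proof -
  obtain r where r: "absQ (c - of_rat r) < 1 / real p"
    using absQ_dense[of "1 / real p" c] p_gt_1 by auto
  obtain a b where ab: "quotient_of r = (a, b)"
    by force
  have "1 / real p \<le> 1"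
    using p_gt_1 by simp
  then have "absQ (of_rat r - c) \<le> 1"
    using r unfolding Q.v_diff_commute[of "of_rat r" c] by linarith
  then have "absQ (of_rat r) \<le> 1"
    using Q.v_add_le[of "of_rat r - c" 1 c] assms by simp
  then have b: "\<not> int p dvd b"
    using not_dvd_denominator[OF prime_p _ ab] by (simp add: absQ_of_rat)
  then have b0: "b \<noteq> 0"
    by auto
  obtain d where d: "int p dvd b * d - 1"
    using int_inverse_mod_prime[OF prime_p b] .
  have "of_rat r = (of_int a / of_int b :: 'q)"
    by (simp add: quotient_of_div[OF ab] of_rat_divide)
  then have "of_rat r - of_int (a * d) = (of_int a / of_int b :: 'q) - of_int a * of_int d"
    by simp
  also have "\<dots> = of_int (a * (1 - b * d)) / of_int b"
    using b0 by (simp add: right_diff_distrib diff_divide_distrib)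
  also have "absQ \<dots> = absQ (of_int (a * (1 - b * d)))"
    unfolding Q.v_divide absQ_of_int[of b] padic_abs_unit[OF b] by (rule div_by_1)
  also have "\<dots> \<le> 1 / real p"
    using d by (intro absQ_dvd dvd_mult) (simp only: dvd_diff_commute)
  finally have "absQ (c - of_int (a * d)) \<le> 1 / real p"
    using Q.v_diff_trans[of c "of_rat r"] less_imp_le[OF r] by blast
  then show ?thesis ..
qed

lemma complete:
  fixes s :: "nat \<Rightarrow> 'q"
  assumes "\<And>\<epsilon>. 0 < \<epsilon> \<Longrightarrow> \<exists>N. \<forall>i\<ge>N. \<forall>j\<ge>N. absQ (s i - s j) < \<epsilon>"
  shows "\<exists>c. \<forall>\<epsilon>>0. \<exists>N. \<forall>i\<ge>N. absQ (s i - c) < \<epsilon>"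
proof -
  interpret M: Metric_space UNIV "\<lambda>x y. absQ (x - y)"
  proof
    fix x y z :: 'q
    show "absQ (x - z) \<le> absQ (x - y) + absQ (y - z)"
      using absolute_value_triangle[OF absQ, of "x - y" "y - z"] by simp
  qed (simp_all add: Q.v_diff_commute)
  have "M.MCauchy s"
    using assms unfolding M.MCauchy_def by auto
  moreover have "M.mcomplete"
    using padic unfolding padic_numbers_def by blast
  ultimately obtain c where "limitin M.mtopology s c sequentially"
    unfolding M.mcomplete_def by blast
  then show ?thesis
    unfolding M.limit_metric_sequentially by auto
qed

section \<open>Integral bases and residue classes modulo p\<close>

text \<open>The reductions of \<^term>\<open>S\<close> modulo $p$ are linearly independent over the field with $p$ elements.\<close>
definition free_mod_p :: "'a set \<Rightarrow> bool" where
  "free_mod_p S \<longleftrightarrow> finite S \<and> S \<subseteq> {x. absK x \<le> 1} \<and>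
     (\<forall>a::'a \<Rightarrow> int. absK (\<Sum>y\<in>S. of_int (a y) * y) \<le> 1 / real p \<longrightarrow> (\<forall>y\<in>S. int p dvd a y))"

lemma free_mod_p_finite: "free_mod_p S \<Longrightarrow> finite S"
  and free_mod_p_le_1: "free_mod_p S \<Longrightarrow> y \<in> S \<Longrightarrow> absK y \<le> 1"
  and free_mod_p_dvd: "free_mod_p S \<Longrightarrow> absK (\<Sum>y\<in>S. of_int (a y) * y) \<le> 1 / real p \<Longrightarrow>
    y \<in> S \<Longrightarrow> int p dvd a y"
  unfolding free_mod_p_def by blast+

lemma absK_combination_le:
  assumes "free_mod_p S" "0 \<le> \<delta>" "\<And>y. y \<in> S \<Longrightarrow> absK (c y) \<le> \<delta>"
  shows "absK (\<Sum>y\<in>S. c y * y) \<le> \<delta>"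
proof (rule K.v_sum_le[OF assms(2)])
  fix y assume "y \<in> S"
  then have "absK (y * c y) \<le> \<delta>"
    using free_mod_p_le_1 assms by (intro K.v_mult_le)
  then show "absK (c y * y) \<le> \<delta>"
    by (simp add: mult.commute)
qed

text \<open>Normalize a relation so that its largest coefficient is $1$, and reduce it modulo $p$.\<close>
lemma free_mod_p_independent:
  assumes S: "free_mod_p S"
  shows "V.independent S"
proof (rule V.independent_if_scalars_zero[OF free_mod_p_finite[OF S]], rule ccontr)
  fix f x0 assume sum: "(\<Sum>x\<in>S. ext_scale \<iota> (f x) x) = 0" and x0: "x0 \<in> S" "f x0 \<noteq> 0"
  have fin: "finite S" "S \<noteq> {}"
    using free_mod_p_finite[OF S] x0 by auto
  have "Max ((\<lambda>x. absQ (f x)) ` S) \<in> (\<lambda>x. absQ (f x)) ` S"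
    using fin by (intro Max_in) auto
  then obtain y where y: "y \<in> S" "absQ (f y) = Max ((\<lambda>x. absQ (f x)) ` S)"
    by force
  have max: "absQ (f x) \<le> absQ (f y)" if "x \<in> S" for x
    using that fin by (simp add: y(2))
  have fy: "f y \<noteq> 0"
    using max[OF x0(1)] x0(2) Q.v_pos_iff by (metis Q.v_eq_0_iff Q.v_nonneg order_antisym)
  \<comment> \<open>Dividing by the largest coefficient makes all coefficients integral and that of
    \<open>y\<close> equal to 1.\<close>
  define u where "u x = f x / f y" for x
  have "\<forall>x\<in>S. \<exists>a::int. absQ (u x - of_int a) \<le> 1 / real p"
    using max fy by (intro ballI approx_by_int) (simp add: u_def Q.v_divide)
  from bchoice[OF this] obtain a :: "'a \<Rightarrow> int"
    where a: "\<And>x. x \<in> S \<Longrightarrow> absQ (u x - of_int (a x)) \<le> 1 / real p"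
    by blast
  have "\<iota> (u x) = \<iota> (1 / f y) * \<iota> (f x)" for x
    by (simp add: u_def flip: iota_mult)
  then have "(\<Sum>x\<in>S. \<iota> (u x) * x) = \<iota> (1 / f y) * (\<Sum>x\<in>S. ext_scale \<iota> (f x) x)"
    by (simp add: ext_scale_def sum_distrib_left mult.assoc)
  then have "(\<Sum>x\<in>S. of_int (a x) * x) = - (\<Sum>x\<in>S. \<iota> (u x - of_int (a x)) * x)"
    using sum by (simp add: iota_diff left_diff_distrib sum_subtractf)
  moreover have "absK (\<Sum>x\<in>S. \<iota> (u x - of_int (a x)) * x) \<le> 1 / real p"
    using a by (intro absK_combination_le[OF S]) (simp_all add: absK_iota)
  ultimately have "absK (\<Sum>x\<in>S. of_int (a x) * x) \<le> 1 / real p"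
    by simp
  \<comment> \<open>p divides \<open>a y\<close> although \<open>a y\<close> is congruent to 1
    modulo p, so |1| \<le> 1/p.\<close>
  then have "absQ (of_int (a y)) \<le> 1 / real p"
    using free_mod_p_dvd[OF S _ y(1)] absQ_dvd by blast
  moreover have "absQ (1 - of_int (a y)) \<le> 1 / real p"
    using a[OF y(1)] fy by (simp add: u_def)
  ultimately have "absQ ((1 - of_int (a y)) + of_int (a y)) \<le> 1 / real p"
    by (intro Q.v_add_le)
  then show False
    using p_gt_1 by simp
qed

text \<open>Families free modulo p are linearly independent over the base field, so a finite
  spanning set bounds their cardinality.\<close>

lemma maximal_free_mod_p:
  obtains S where "free_mod_p S" "\<And>S'. free_mod_p S' \<Longrightarrow> card S' \<le> card S"
proof -
  obtain T where T: "finite T" "V.span T = UNIV"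
    using ext unfolding finite_field_extension_def by blast
  have "card S \<le> card T" if "free_mod_p S" for S
    using V.independent_span_bound[OF T(1) free_mod_p_independent[OF that]] T(2) by simp
  moreover have "free_mod_p {}"
    by (simp add: free_mod_p_def)
  ultimately have "\<exists>S. free_mod_p S \<and> (\<forall>S'. free_mod_p S' \<longrightarrow> card S' \<le> card S)"
    by (intro ex_has_greatest_nat[of free_mod_p "{}" card "Suc (card T)"]) (auto simp: le_Suc_eq less_Suc_eq_le)
  then show ?thesis
    using that by blast
qed

text \<open>Adjoining a new x to a maximal family creates a nontrivial relation modulo p. Its
  x-coefficient is invertible modulo p, since otherwise a nontrivial relation within
  \<open>S\<close> would remain; multiply by the inverse and solve for x.\<close>

lemma maximal_free_mod_p_generates:
  assumes S: "free_mod_p S" and max: "\<And>S'. free_mod_p S' \<Longrightarrow> card S' \<le> card S" and x: "absK x \<le> 1"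
  shows "\<exists>a::'a \<Rightarrow> int. absK (x - (\<Sum>y\<in>S. of_int (a y) * y)) \<le> 1 / real p"
proof (cases "x \<in> S")
  case True
  then have "(\<Sum>y\<in>S. of_int (if y = x then 1 else 0) * y) = x"
    using free_mod_p_finite[OF S] by (simp add: if_distrib if_distribR cong: if_cong)
  then show ?thesis
    by (intro exI[of _ "\<lambda>y. if y = x then 1 else 0"]) simp
next
  case False
  have fin: "finite S"
    using S by (rule free_mod_p_finite)
  have "\<not> free_mod_p (insert x S)"
    using max[of "insert x S"] False fin by auto
  then obtain a y where a: "absK (of_int (a x) * x + (\<Sum>y\<in>S. of_int (a y) * y)) \<le> 1 / real p"
    and y: "y \<in> insert x S" "\<not> int p dvd a y"
    using False fin S x unfolding free_mod_p_def by auto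
  have "\<not> int p dvd a x"
  proof
    assume "int p dvd a x"
    then have "absK (x * of_int (a x)) \<le> 1 / real p"
      by (intro K.v_mult_le x absK_dvd)
    then have "absK ((of_int (a x) * x + (\<Sum>y\<in>S. of_int (a y) * y)) - x * of_int (a x)) \<le> 1 / real p"
      by (intro K.v_diff_le a)
    then have "\<forall>y\<in>S. int p dvd a y"
      using free_mod_p_dvd[OF S] by (simp add: algebra_simps)
    then show False
      using y \<open>int p dvd a x\<close> by auto
  qed
  then obtain c where c: "int p dvd a x * c - 1"
    using int_inverse_mod_prime[OF prime_p] by blast
  have "absK (of_int c * (of_int (a x) * x + (\<Sum>y\<in>S. of_int (a y) * y))) \<le> 1 / real p"
    by (intro K.v_mult_le K.v_of_int_le_1 a)
  moreover have "absK (x * of_int (a x * c - 1)) \<le> 1 / real p"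
    using c by (intro K.v_mult_le x absK_dvd)
  ultimately have "absK (of_int c * (of_int (a x) * x + (\<Sum>y\<in>S. of_int (a y) * y))
      - x * of_int (a x * c - 1)) \<le> 1 / real p"
    by (rule K.v_diff_le)
  also have "of_int c * (of_int (a x) * x + (\<Sum>y\<in>S. of_int (a y) * y)) - x * of_int (a x * c - 1)
      = x - (\<Sum>y\<in>S. of_int (- c * a y) * y)"
    by (simp add: algebra_simps sum_distrib_left sum_negf)
  finally show ?thesis
    by (rule exI[of _ "\<lambda>y. - c * a y"])
qed

text \<open>Solving $x \equiv \sum_y a_y y$ modulo $p$ repeatedly gives $p$-adic expansions of the
  coordinates of \<^term>\<open>x\<close>; only completeness of the base field is used.\<close>
lemma integral_in_span:
  assumes S: "free_mod_p S"
    and gen: "\<And>x. absK x \<le> 1 \<Longrightarrow> \<exists>a::'a \<Rightarrow> int. absK (x - (\<Sum>y\<in>S. of_int (a y) * y)) \<le> 1 / real p"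
    and x: "absK x \<le> 1"
  shows "x \<in> V.span S"
proof -
  obtain \<alpha> :: "'a \<Rightarrow> 'a \<Rightarrow> int" where
    \<alpha>: "\<And>x. absK x \<le> 1 \<Longrightarrow> absK (x - (\<Sum>y\<in>S. of_int (\<alpha> x y) * y)) \<le> 1 / real p"
    using gen by metis
  \<comment> \<open>The error of one approximation is divided by p; the quotient is again integral,
    so the procedure iterates.\<close>
  define t where "t x = (x - (\<Sum>y\<in>S. of_int (\<alpha> x y) * y)) / of_nat p" for x
  have t1: "absK (t x) \<le> 1" if "absK x \<le> 1" for x
    using \<alpha>[OF that] p_gt_1 by (simp add: t_def K.v_divide absK_p field_simps)
  have it1: "absK ((t ^^ k) x) \<le> 1" for k
    by (induction k) (simp_all add: x t1)
  \<comment> \<open>\<open>C k y\<close> is the k-digit truncation of the coordinate at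
    \<open>y\<close>; it lives in the base field, where completeness is available.\<close>
  define C where "C k y = (\<Sum>j<k. of_nat p ^ j * of_int (\<alpha> ((t ^^ j) x) y) :: 'q)" for k y
  have expand: "x = (\<Sum>y\<in>S. \<iota> (C k y) * y) + of_nat p ^ k * (t ^^ k) x" for k
  proof (induction k)
    case (Suc k)
    have "(t ^^ k) x = (\<Sum>y\<in>S. of_int (\<alpha> ((t ^^ k) x) y) * y) + of_nat p * t ((t ^^ k) x)"
      by (simp add: t_def)
    then have "of_nat p ^ k * (t ^^ k) x
        = of_nat p ^ k * ((\<Sum>y\<in>S. of_int (\<alpha> ((t ^^ k) x) y) * y) + of_nat p * t ((t ^^ k) x))"
      by (rule arg_cong)
    also have "\<dots>
        = (\<Sum>y\<in>S. of_nat p ^ k * of_int (\<alpha> ((t ^^ k) x) y) * y) + of_nat p ^ Suc k * (t ^^ Suc k) x"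
      by (simp add: distrib_left sum_distrib_left mult.assoc mult.left_commute)
    finally have "of_nat p ^ k * (t ^^ k) x
        = (\<Sum>y\<in>S. of_nat p ^ k * of_int (\<alpha> ((t ^^ k) x) y) * y) + of_nat p ^ Suc k * (t ^^ Suc k) x" .
    moreover have "(\<Sum>y\<in>S. \<iota> (C (Suc k) y) * y)
        = (\<Sum>y\<in>S. \<iota> (C k y) * y) + (\<Sum>y\<in>S. of_nat p ^ k * of_int (\<alpha> ((t ^^ k) x) y) * y)"
      by (simp add: C_def iota_add iota_mult iota_power distrib_right sum.distrib)
    ultimately show ?case
      using Suc.IH by (simp only: add.assoc)
  qed (simp add: C_def)
  have step: "absQ (C i y - C k y) \<le> (1 / real p) ^ k" if "k \<le> i" for i k y
  proof -
    have "C i y - C k y = (\<Sum>j\<in>{k..<i}. of_nat p ^ j * of_int (\<alpha> ((t ^^ j) x) y))"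
      using that unfolding C_def by (simp add: sum_diff_nat_ivl[of 0 k i, symmetric] lessThan_atLeast0)
    also have "absQ \<dots> \<le> (1 / real p) ^ k"
    proof (rule Q.v_sum_le)
      fix j assume "j \<in> {k..<i}"
      then have "(1 / real p) ^ j \<le> (1 / real p) ^ k"
        using p_gt_1 by (intro power_decreasing) simp_all
      then have "absQ (of_int (\<alpha> ((t ^^ j) x) y) * of_nat p ^ j) \<le> (1 / real p) ^ k"
        by (intro Q.v_mult_le Q.v_of_int_le_1) (simp add: Q.v_power absQ_p)
      then show "absQ (of_nat p ^ j * of_int (\<alpha> ((t ^^ j) x) y)) \<le> (1 / real p) ^ k"
        by (simp add: mult.commute)
    qed simp
    finally show ?thesis .
  qed
  have small: "\<exists>N. (1 / real p) ^ N < \<epsilon>" if "0 < \<epsilon>" for \<epsilon>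
    using real_arch_pow_inv[OF that, of "1 / real p"] p_gt_1 by simp
  have "\<exists>c. \<forall>\<epsilon>>0. \<exists>N. \<forall>i\<ge>N. absQ (C i y - c) < \<epsilon>" for y
  proof (rule complete)
    fix \<epsilon> :: real assume "0 < \<epsilon>"
    then obtain N where N: "(1 / real p) ^ N < \<epsilon>"
      using small by blast
    have "absQ (C i y - C j y) < \<epsilon>" if "N \<le> i" "N \<le> j" for i j
      using Q.v_diff_trans[of "C i y" "C N y" "(1 / real p) ^ N" "C j y"] step[of N i y] step[of N j y]
        that N by (simp add: Q.v_diff_commute)
    then show "\<exists>N. \<forall>i\<ge>N. \<forall>j\<ge>N. absQ (C i y - C j y) < \<epsilon>"
      by blast
  qed
  then obtain c where c: "\<And>y \<epsilon>. 0 < \<epsilon> \<Longrightarrow> \<exists>N. \<forall>i\<ge>N. absQ (C i y - c y) < \<epsilon>"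
    by metis
  \<comment> \<open>The difference splits into the coordinate errors and the remainder of
    \<open>expand\<close>; both become arbitrarily small.\<close>
  have "absK (x - (\<Sum>y\<in>S. \<iota> (c y) * y)) \<le> 0"
  proof (rule field_le_epsilon)
    fix \<epsilon> :: real assume \<epsilon>: "0 < \<epsilon>"
    obtain N where N: "(1 / real p) ^ N < \<epsilon>"
      using small[OF \<epsilon>] by blast
    have "eventually (\<lambda>i. absQ (C i y - c y) < \<epsilon>) sequentially" for y
      using c[OF \<epsilon>] by (simp add: eventually_sequentially)
    then have "eventually (\<lambda>i. \<forall>y\<in>S. absQ (C i y - c y) < \<epsilon>) sequentially"
      using free_mod_p_finite[OF S] by (simp add: eventually_ball_finite)
    then obtain M where M: "\<And>i y. M \<le> i \<Longrightarrow> y \<in> S \<Longrightarrow> absQ (C i y - c y) < \<epsilon>"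
      unfolding eventually_sequentially by blast
    define i where "i = max M N"
    have "x - (\<Sum>y\<in>S. \<iota> (c y) * y) = (\<Sum>y\<in>S. \<iota> (C i y - c y) * y) + (t ^^ i) x * of_nat p ^ i"
      by (subst expand[of i]) (simp add: iota_diff left_diff_distrib sum_subtractf mult.commute[of "(t ^^ i) x"])
    moreover have "absK (\<Sum>y\<in>S. \<iota> (C i y - c y) * y) \<le> \<epsilon>"
      using M[of i] \<epsilon> by (intro absK_combination_le[OF S]) (simp_all add: absK_iota i_def less_imp_le)
    moreover have "(1 / real p) ^ i \<le> (1 / real p) ^ N"
      using p_gt_1 by (intro power_decreasing) (simp_all add: i_def)
    then have "absK ((t ^^ i) x * of_nat p ^ i) \<le> \<epsilon>"
      using N by (intro K.v_mult_le it1) (simp add: K.v_power absK_p)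
    ultimately show "absK (x - (\<Sum>y\<in>S. \<iota> (c y) * y)) \<le> 0 + \<epsilon>"
      by (simp add: K.v_add_le)
  qed
  then have "absK (x - (\<Sum>y\<in>S. \<iota> (c y) * y)) = 0"
    using K.v_nonneg by (rule antisym)
  then have "x = (\<Sum>y\<in>S. ext_scale \<iota> (c y) y)"
    by (simp add: ext_scale_def)
  then show ?thesis
    by (simp add: V.span_sum V.span_scale V.span_base)
qed

text \<open>A power of p carries any element of K into the ring of integers, so a maximal family
  spans K and is a basis.\<close>

lemma integral_basis:
  obtains S where "free_mod_p S" "card S = ext_degree \<iota>"
    "\<And>x. absK x \<le> 1 \<Longrightarrow> \<exists>a::'a \<Rightarrow> int. absK (x - (\<Sum>y\<in>S. of_int (a y) * y)) \<le> 1 / real p"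
proof -
  obtain S where S: "free_mod_p S" "\<And>S'. free_mod_p S' \<Longrightarrow> card S' \<le> card S"
    using maximal_free_mod_p by blast
  note gen = maximal_free_mod_p_generates[OF S]
  have "x \<in> V.span S" for x
  proof -
    obtain N where N: "absK x < real p ^ N"
      using real_arch_pow[OF p_gt_1] ..
    have "absK (of_nat p ^ N * x) \<le> 1"
      using N p_gt_1 by (simp add: K.v_mult K.v_power absK_p power_one_over field_simps)
    with S(1) gen have "of_nat p ^ N * x \<in> V.span S"
      by (rule integral_in_span)
    then have "ext_scale \<iota> (1 / of_nat p ^ N) (of_nat p ^ N * x) \<in> V.span S"
      by (rule V.span_scale)
    moreover have "\<iota> (1 / of_nat p ^ N) * (of_nat p ^ N) = 1"
      using prime_gt_0_nat[OF prime_p]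
      by (simp flip: iota_of_nat iota_power iota_mult)
    ultimately show ?thesis
      by (simp add: ext_scale_def flip: mult.assoc)
  qed
  then have "V.span S = V.span UNIV"
    by auto
  then have "card S = ext_degree \<iota>"
    unfolding ext_degree_def using V.dim_eq_card free_mod_p_independent[OF S(1)] by metis
  with S(1) gen show ?thesis
    using that by blast
qed

text \<open>Each class modulo p has exactly one expansion with coefficients in {0, ..., p-1}:
  existence is generation, uniqueness is freeness.\<close>

lemma residue_system_mod_p:
  obtains T where "K.residue_system (1 / real p) T" "card T = p ^ ext_degree \<iota>"
proof -
  obtain S where S: "free_mod_p S" "card S = ext_degree \<iota>"
    and gen: "\<And>x. absK x \<le> 1 \<Longrightarrow> \<exists>a::'a \<Rightarrow> int. absK (x - (\<Sum>y\<in>S. of_int (a y) * y)) \<le> 1 / real p"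
    using integral_basis by blast
  have fin: "finite S"
    using S(1) by (rule free_mod_p_finite)
  define h where "h a = (\<Sum>y\<in>S. of_int (a y) * y)" for a :: "'a \<Rightarrow> int"
  define D where "D = S \<rightarrow>\<^sub>E {0..<int p}"
  have h_eq: "a = b" if "a \<in> D" "b \<in> D" "absK (h a - h b) \<le> 1 / real p" for a b
  proof (rule PiE_ext)
    show "a \<in> S \<rightarrow>\<^sub>E {0..<int p}" "b \<in> S \<rightarrow>\<^sub>E {0..<int p}"
      using that by (simp_all add: D_def)
    fix y assume y: "y \<in> S"
    have "h a - h b = (\<Sum>y\<in>S. of_int (a y - b y) * y)"
      by (simp add: h_def left_diff_distrib sum_subtractf)
    then have "int p dvd a y - b y"
      using free_mod_p_dvd[OF S(1), of "\<lambda>y. a y - b y"] that(3) y by simp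
    then have "a y mod int p = b y mod int p"
      by (simp add: mod_eq_dvd_iff)
    moreover have "a y \<in> {0..<int p}" "b y \<in> {0..<int p}"
      using that y by (auto simp: D_def)
    ultimately show "a y = b y"
      by simp
  qed
  have "K.residue_system (1 / real p) (h ` D)"
  proof (rule K.residue_systemI)
    show "finite (h ` D)"
      using fin by (simp add: D_def finite_PiE)
  next
    fix r assume "r \<in> h ` D"
    then show "absK r \<le> 1"
      unfolding h_def by (auto intro!: absK_combination_le[OF S(1)] K.v_of_int_le_1)
  next
    fix x assume "absK x \<le> 1"
    then obtain a :: "'a \<Rightarrow> int" where a: "absK (x - h a) \<le> 1 / real p"
      using gen unfolding h_def by blast
    define b where "b = restrict (\<lambda>y. a y mod int p) S"
    have "b \<in> D"
      using prime_gt_0_nat[OF prime_p] by (auto simp: b_def D_def)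
    have "h a - h b = (\<Sum>y\<in>S. of_int (a y - a y mod int p) * y)"
      by (simp add: h_def b_def left_diff_distrib sum_subtractf)
    also have "absK \<dots> \<le> 1 / real p"
      by (intro absK_combination_le[OF S(1)] absK_dvd) simp_all
    finally have "absK (x - h b) \<le> 1 / real p"
      by (rule K.v_diff_trans[OF a])
    then show "\<exists>r\<in>h ` D. absK (x - r) \<le> 1 / real p"
      using \<open>b \<in> D\<close> by blast
  next
    fix r s assume "r \<in> h ` D" "s \<in> h ` D" "absK (r - s) \<le> 1 / real p"
    then show "r = s"
      using h_eq by blast
  qed
  moreover have "inj_on h D"
    by (rule inj_onI) (use h_eq in simp)
  then have "card (h ` D) = p ^ ext_degree \<iota>"
    using fin by (simp add: card_image D_def card_PiE S(2))
  ultimately show ?thesis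
    by (rule that)
qed

section \<open>Value group, ramification index and residue field\<close>

text \<open>Finiteness of the integers modulo p makes the value group discrete:
  \<open>max_value_exists\<close> applies with \<kappa> = p.\<close>

lemma value_group_generator:
  obtains \<pi> where "\<pi> \<noteq> 0" "absK \<pi> < 1" "\<And>x. absK x < 1 \<Longrightarrow> absK x \<le> absK \<pi>"
proof -
  obtain T where T: "K.residue_system (1 / real p) T"
    using residue_system_mod_p .
  show ?thesis
  proof (rule K.max_value_exists[of T "of_nat p"])
    show "finite T"
      using T unfolding K.residue_system_def by blast
    show "\<exists>t\<in>T. absK (x - t) \<le> absK (of_nat p)" if "absK x \<le> 1" for x
      using K.residue_system_obtain[OF T that] unfolding absK_p by blast
  qed (use that p_gt_1 in \<open>simp_all add: absK_p\<close>)
qed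

text \<open>Uniqueness of e: if (1/a)Z = (1/b)Z, then 1/b = k/a for an integer k, so b divides a,
  and by symmetry a = b.\<close>

lemma ramification_index_eqI:
  assumes "0 < e" "padic_val p absK ` (UNIV - {0}) = range (\<lambda>k::int. of_int k / real e)"
  shows "ramification_index p absK = e"
  unfolding ramification_index_def
proof (rule the_equality)
  fix e' assume e': "0 < e' \<and> padic_val p absK ` (UNIV - {0}) = range (\<lambda>k::int. of_int k / real e')"
  have dvd: "b dvd a" if "0 < a" "0 < b"
    "range (\<lambda>k::int. of_int k / real a) = range (\<lambda>k::int. of_int k / real b)" for a b
  proof -
    have "1 / real b \<in> range (\<lambda>k::int. of_int k / real a)"
      unfolding that(3) by (rule range_eqI[of _ _ 1]) simp
    then obtain k :: int where "1 / real b = of_int k / real a"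
      by blast
    then have "real a = of_int k * real b"
      using that(1,2) by (simp add: field_simps)
    then have "int a = k * int b"
      by (metis of_int_eq_iff of_int_mult of_int_of_nat_eq)
    then show "b dvd a"
      by (metis dvd_triv_right int_dvd_int_iff)
  qed
  show "e' = e"
    using dvd[of e e'] dvd[of e' e] assms e' by (intro dvd_antisym) auto
qed (use assms in simp)

text \<open>Compare \<pi> with a generator \<pi>0 of the value group. If |p| = |\<pi>0|^e, the
  valuations are the multiples of 1/e, so e is the ramification index; then \<pi> and \<pi>0 have
  equal valuations, and injectivity of the logarithm gives |\<pi>| = |\<pi>0|.\<close>

lemma uniformizer_properties:
  assumes unif: "uniformizer p absK \<pi>"
  shows "0 < ramification_index p absK" "absK \<pi> ^ ramification_index p absK = 1 / real p"
    and "absK \<pi> < 1" "\<And>x. absK x < 1 \<Longrightarrow> absK x \<le> absK \<pi>"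
proof -
  obtain \<pi>0 where \<pi>0: "\<pi>0 \<noteq> 0" "absK \<pi>0 < 1" "\<And>x. absK x < 1 \<Longrightarrow> absK x \<le> absK \<pi>0"
    using value_group_generator by blast
  obtain e where e: "absK (of_nat p) = absK \<pi>0 ^ e"
    using K.value_group_generated[OF \<pi>0, of "of_nat p"] absK_p p_gt_1 by auto
  then have e': "absK \<pi>0 ^ e = 1 / real p"
    using absK_p by simp
  have e0: "0 < e"
    using e' p_gt_1 by (cases e) simp_all
  have val0: "padic_val p absK \<pi>0 = 1 / real e"
  proof -
    have "real e * log (real p) (absK \<pi>0) = log (real p) (absK \<pi>0 ^ e)"
      using \<pi>0(1) by (simp add: log_nat_power)
    also have "\<dots> = - 1"
      using p_gt_1 by (simp add: e' log_divide)
    finally show ?thesis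
      using e0 by (simp add: padic_val_def field_simps)
  qed
  have val: "padic_val p absK x = of_int k / real e" if "absK x = absK \<pi>0 powi k" for x k
  proof -
    have "padic_val p absK x = - log (real p) (absK \<pi>0 powr of_int k)"
      using \<pi>0(1) that by (simp add: padic_val_def powr_real_of_int')
    also have "\<dots> = of_int k * padic_val p absK \<pi>0"
      using \<pi>0(1) by (simp add: padic_val_def log_powr)
    finally show ?thesis
      by (simp add: val0)
  qed
  have "padic_val p absK ` (UNIV - {0}) = range (\<lambda>k::int. of_int k / real e)"
  proof (intro equalityI subsetI)
    fix y assume "y \<in> padic_val p absK ` (UNIV - {0})"
    then obtain x where x: "x \<noteq> 0" "y = padic_val p absK x"
      by blast
    then show "y \<in> range (\<lambda>k::int. of_int k / real e)"
      using K.value_group_generated_int[OF \<pi>0 x(1)] val by auto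
  next
    fix y assume "y \<in> range (\<lambda>k::int. of_int k / real e)"
    then obtain k :: int where k: "y = of_int k / real e"
      by blast
    have "absK (\<pi>0 powi k) = absK \<pi>0 powi k"
      by (cases k rule: int_cases2)
        (simp_all add: power_int_minus K.v_power inverse_eq_divide K.v_divide)
    then have "y = padic_val p absK (\<pi>0 powi k)"
      using val k by simp
    moreover have "\<pi>0 powi k \<noteq> 0"
      using \<pi>0(1) by simp
    ultimately show "y \<in> padic_val p absK ` (UNIV - {0})"
      by blast
  qed
  then have ram: "ramification_index p absK = e"
    by (rule ramification_index_eqI[OF e0])
  then have "padic_val p absK \<pi> = padic_val p absK \<pi>0" "\<pi> \<noteq> 0"
    using unif val0 by (simp_all add: uniformizer_def)
  then have eq: "absK \<pi> = absK \<pi>0"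
    using \<pi>0(1) inj_onD[OF log_inj[OF p_gt_1]] by (simp add: padic_val_def)
  show "0 < ramification_index p absK" "absK \<pi> ^ ramification_index p absK = 1 / real p"
    "absK \<pi> < 1" "\<And>x. absK x < 1 \<Longrightarrow> absK x \<le> absK \<pi>"
    using ram e0 e' \<pi>0 by (simp_all add: eq)
qed

text \<open>As |p| = |\<pi>|^e, counting the integers modulo p in two ways gives (card R)^e =
  p^[K:Q_p]. Hence \<open>card R\<close> is a power p^i with i e = [K:Q_p], so the integer division
  is exact.\<close>

lemma residue_field_card:
  assumes unif: "uniformizer p absK \<pi>"
  shows "\<exists>R. K.residue_system (absK \<pi>) R \<and>
    card R = p ^ (ext_degree \<iota> div ramification_index p absK)"
proof -
  let ?e = "ramification_index p absK"
  note \<pi> = uniformizer_properties[OF unif]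
  have \<pi>0: "\<pi> \<noteq> 0"
    using unif by (simp add: uniformizer_def)
  obtain T where T: "K.residue_system (1 / real p) T" "card T = p ^ ext_degree \<iota>"
    using residue_system_mod_p .
  have "absK \<pi> ^ ?e \<le> absK \<pi>"
    using power_decreasing[of 1 ?e "absK \<pi>"] \<pi>(1,3) by simp
  then have le: "1 / real p \<le> absK \<pi>"
    by (simp add: \<pi>(2))
  \<comment> \<open>Since 1/p \<le> |\<pi>|, a system modulo p meets every class modulo
    \<pi>.\<close>
  obtain R where R: "K.residue_system (absK \<pi>) R"
  proof (rule K.residue_system_exists[of T "absK \<pi>"])
    show "finite T" "\<And>t. t \<in> T \<Longrightarrow> absK t \<le> 1"
      using T(1) unfolding K.residue_system_def by blast+
    fix x assume "absK x \<le> 1"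
    then obtain t where "t \<in> T" "absK (x - t) \<le> 1 / real p"
      using K.residue_system_obtain[OF T(1)] by blast
    then show "\<exists>t\<in>T. absK (x - t) \<le> absK \<pi>"
      using le by (intro bexI[of _ t]) simp_all
  qed simp_all
  obtain S where S: "K.residue_system (absK \<pi> ^ ?e) S" "card S = card R ^ ?e"
    using K.residue_system_power[OF R \<pi>0, of ?e] \<pi>(3) by auto
  have "card R ^ ?e = p ^ ext_degree \<iota>"
    using K.residue_system_card_eq[OF S(1)[unfolded \<pi>(2)] T(1)] S(2) T(2) by simp
  moreover from this have "card R dvd p ^ ext_degree \<iota>"
    using dvd_power[OF disjI1[OF \<pi>(1)], of "card R"] by simp
  then obtain i where i: "card R = p ^ i"
    using divides_primepow_nat[OF prime_p] by blast
  ultimately have "p ^ (i * ?e) = p ^ ext_degree \<iota>"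
    by (simp add: power_mult)
  then have "i * ?e = ext_degree \<iota>"
    using prime_gt_1_nat[OF prime_p] by simp
  then have "ext_degree \<iota> div ?e = i"
    using \<pi>(1) by (metis nonzero_mult_div_cancel_right less_numeral_extra(3))
  with R i show ?thesis
    by auto
qed

end

section \<open>Expansion on the ring of integers\<close>

text \<open>Isolates the arithmetic input to the dynamics: q is divisible by \<pi>, and z^q = z
  holds on the residue field.\<close>

locale expanding_system = nonarch_abs v for v :: "'a::field \<Rightarrow> real" +
  fixes \<pi> :: 'a and q m n :: nat
  assumes v_pi: "0 < v \<pi>" "v \<pi> < 1"
    and q_gt_1: "1 < q"
    and v_q: "v (of_nat q) \<le> v \<pi>"
    and v_frob: "v x \<le> 1 \<Longrightarrow> v (x ^ q - x) \<le> v \<pi>"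
    and n_pos: "0 < n" and n_less_m: "n < m"
begin

definition A :: "'a poly" where "A = [:0, 1:] ^ q - [:0, 1:]"
definition B :: "'a poly" where "B = [:\<pi>:] + [:0, 1:] ^ (q ^ m) - [:0, 1:] ^ (q ^ n)"
text \<open>The rational map in the affine chart; by \<open>poly_B_nonzero\<close> it has no affine
  poles.\<close>

definition g :: "'a \<Rightarrow> 'a" where "g x = poly A x / poly B x"

lemma pi_nonzero [simp]: "\<pi> \<noteq> 0"
  using v_pi(1) by simp

lemma poly_A: "poly A x = x ^ q - x"
  by (simp add: A_def)

lemma poly_B: "poly B x = \<pi> + x ^ q ^ m - x ^ q ^ n"
  by (simp add: B_def)

lemma q_power_less: "i < j \<Longrightarrow> q ^ i < q ^ j"
  using q_gt_1 by (rule power_strict_increasing[rotated])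

lemma q_less_q_power_m: "q < q ^ m"
  using q_power_less[of 1 m] n_pos n_less_m by simp

lemma X_power: "[:0, 1:] ^ k = (monom 1 k :: 'a poly)"
  by (simp add: monom_altdef)

lemma coeff_A: "coeff A k = (if k = q then 1 else 0) - (if k = 1 then 1 else 0)"
proof -
  have "A = monom 1 q - monom 1 1"
    unfolding A_def X_power[symmetric] by simp
  then show ?thesis
    by simp
qed

lemma coeff_B:
  "coeff B k = (if k = 0 then \<pi> else 0) + (if k = q ^ m then 1 else 0) - (if k = q ^ n then 1 else 0)"
proof -
  have "[:\<pi>:] = monom \<pi> 0"
    by (simp add: monom_0)
  then show ?thesis
    by (auto simp: B_def X_power)
qed

lemma degree_A: "degree A = q"
  using q_gt_1 by (intro antisym degree_le le_degree) (auto simp: coeff_A)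

lemma degree_B: "degree B = q ^ m"
  using q_power_less[OF n_less_m] q_gt_1 by (intro antisym degree_le le_degree) (auto simp: coeff_B)

lemma B_nonzero: "B \<noteq> 0"
  using degree_B q_less_q_power_m by (metis degree_0 gr_implies_not0)

text \<open>\<open>A\<close> divides X^(q^k) - X for every k, hence also X^(q^m) - X^(q^n), which is
  \<open>B\<close> minus the constant \<pi>. A common divisor therefore divides a unit. This puts
  A/B in the lowest terms that \<open>rational_map\<close> asks for.\<close>

lemma coprime_A_B: "coprime A B"
proof (rule coprimeI)
  fix c assume c: "c dvd A" "c dvd B"
  have dvd: "A dvd [:0, 1:] ^ (q ^ k) - [:0, 1:]" for k
  proof (induction k)
    case (Suc k)
    have "[:0, 1:] ^ (q ^ k) - [:0, 1:] dvd ([:0, 1:] ^ (q ^ k)) ^ q - ([:0, 1:] :: 'a poly) ^ q"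
      by (subst power_diff_sumr2) (rule dvd_triv_left)
    with Suc.IH have "A dvd ([:0, 1:] ^ (q ^ k)) ^ q - [:0, 1:] ^ q"
      by (rule dvd_trans)
    then have "A dvd (([:0, 1:] ^ (q ^ k)) ^ q - [:0, 1:] ^ q) + A"
      by (rule dvd_add) (rule dvd_refl)
    also have "(([:0, 1:] ^ (q ^ k)) ^ q - [:0, 1:] ^ q) + A = [:0, 1:] ^ (q ^ Suc k) - [:0, 1:]"
      unfolding A_def power_mult[symmetric] power_Suc2 by (simp only: diff_add_cancel add_diff_eq)
    finally show ?case .
  qed simp
  have "A dvd ([:0, 1:] ^ (q ^ m) - [:0, 1:]) - ([:0, 1:] ^ (q ^ n) - [:0, 1:])"
    using dvd by (rule dvd_diff[OF dvd])
  then have "c dvd [:0, 1:] ^ (q ^ m) - [:0, 1:] ^ (q ^ n)"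
    using c(1) dvd_trans by fastforce
  then have "c dvd B - ([:0, 1:] ^ (q ^ m) - [:0, 1:] ^ (q ^ n))"
    using c(2) by (rule dvd_diff[rotated])
  also have "B - ([:0, 1:] ^ (q ^ m) - [:0, 1:] ^ (q ^ n)) = [:\<pi>:]"
    by (simp add: B_def)
  also have "[:\<pi>:] dvd 1"
    by (simp add: is_unit_const_poly_iff dvd_field_iff)
  finally show "c dvd 1" .
qed

section \<open>Estimates inside and outside the unit disc\<close>

text \<open>In the factorization of x^q - y^q by x - y, every summand of the cofactor is congruent
  to y^(q-1) modulo \<pi>, so the cofactor is congruent to q y^(q-1), hence to 0.\<close>

lemma v_power_q_diff:
  assumes "v x \<le> 1" "v y \<le> 1" "v (x - y) \<le> v \<pi>"
  shows "v (x ^ q - y ^ q) \<le> v \<pi> * v (x - y)"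
proof -
  have 1: "v (y ^ (q - Suc i) * x ^ i - y ^ (q - 1)) \<le> v \<pi>" if "i < q" for i
  proof -
    have "v (x ^ i - y ^ i) \<le> v \<pi>"
    proof -
      have "v ((\<Sum>j<i. y ^ (i - Suc j) * x ^ j) * (x - y)) \<le> v \<pi>"
        using assms by (intro v_mult_le v_sum_le) (simp_all add: v_power_le_1)
      then show ?thesis
        by (simp add: power_diff_sumr2 mult.commute)
    qed
    then have "v (y ^ (q - Suc i) * (x ^ i - y ^ i)) \<le> v \<pi>"
      using assms by (intro v_mult_le v_power_le_1)
    also have "y ^ (q - Suc i) * (x ^ i - y ^ i) = y ^ (q - Suc i) * x ^ i - y ^ (q - Suc i + i)"
      by (simp add: right_diff_distrib power_add)
    finally show ?thesis
      using that by simp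
  qed
  have "v (y ^ (q - 1) * of_nat q) \<le> v \<pi>"
    using assms(2) v_q by (intro v_mult_le v_power_le_1)
  moreover have "v (\<Sum>i<q. y ^ (q - Suc i) * x ^ i - y ^ (q - 1)) \<le> v \<pi>"
    using 1 by (intro v_sum_le) simp_all
  ultimately have "v ((\<Sum>i<q. y ^ (q - Suc i) * x ^ i - y ^ (q - 1)) + y ^ (q - 1) * of_nat q) \<le> v \<pi>"
    by (rule v_add_le[rotated])
  also have "(\<Sum>i<q. y ^ (q - Suc i) * x ^ i - y ^ (q - 1)) + y ^ (q - 1) * of_nat q
      = (\<Sum>i<q. y ^ (q - Suc i) * x ^ i)"
    by (simp add: sum_subtractf mult.commute)
  finally have "v (x - y) * v (\<Sum>i<q. y ^ (q - Suc i) * x ^ i) \<le> v (x - y) * v \<pi>"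
    by (intro mult_left_mono) simp_all
  then show ?thesis
    by (simp add: power_diff_sumr2 mult.commute flip: v_mult)
qed

lemma v_power_q_power_diff:
  assumes "v x \<le> 1" "v y \<le> 1" "v (x - y) \<le> v \<pi>" "0 < k"
  shows "v (x ^ q ^ k - y ^ q ^ k) \<le> v \<pi> * v (x - y)"
  using \<open>0 < k\<close>
proof (induction k rule: nat_induct_non_zero)
  case 1
  show ?case
    using v_power_q_diff assms by simp
next
  case (Suc k)
  have le: "v \<pi> * v (x - y) \<le> v (x - y)"
    using v_pi by (simp add: mult_left_le_one_le)
  then have "v (x ^ q ^ k - y ^ q ^ k) \<le> v \<pi>"
    using Suc.IH assms(3) by linarith
  then have "v ((x ^ q ^ k) ^ q - (y ^ q ^ k) ^ q) \<le> v \<pi> * v (x ^ q ^ k - y ^ q ^ k)"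
    using assms by (intro v_power_q_diff v_power_le_1)
  also have "\<dots> \<le> v \<pi> * v (x - y)"
    using Suc.IH le by (intro mult_left_mono) simp_all
  finally show ?case
    by (simp add: mult.commute flip: power_mult)
qed

lemma v_power_q_power_minus_self: "v x \<le> 1 \<Longrightarrow> v (x ^ q ^ k - x) \<le> v \<pi>"
proof (induction k)
  case (Suc k)
  have "v ((x ^ q ^ k) ^ q - x ^ q ^ k) \<le> v \<pi>"
    using Suc.prems by (intro v_frob v_power_le_1)
  then show ?case
    using v_diff_trans[OF _ Suc.IH] Suc.prems by (simp add: mult.commute flip: power_mult)
qed simp

text \<open>x^(q^m) is the q^n-th power of x^(q^(m-n)), which is congruent to x modulo \<pi>. As n >
  0, x^(q^m) and x^(q^n) agree modulo \<pi>^2, so the constant term \<pi> dominates.\<close>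

lemma v_poly_B:
  assumes "v x \<le> 1"
  shows "v (poly B x) = v \<pi>"
proof -
  have "v ((x ^ q ^ (m - n)) ^ q ^ n - x ^ q ^ n) \<le> v \<pi> * v (x ^ q ^ (m - n) - x)"
    using assms n_pos by (intro v_power_q_power_diff v_power_le_1 v_power_q_power_minus_self)
  also have "\<dots> \<le> v \<pi> * v \<pi>"
    using assms by (intro mult_left_mono v_power_q_power_minus_self) simp_all
  also have "\<dots> < v \<pi>"
    using v_pi by simp
  also have "(x ^ q ^ (m - n)) ^ q ^ n = x ^ q ^ m"
    using n_less_m by (simp flip: power_mult power_add)
  finally show ?thesis
    using v_add_eq[of "x ^ q ^ m - x ^ q ^ n" \<pi>] by (simp add: poly_B algebra_simps)
qed

lemma v_poly_B_outside:
  assumes "1 < v x"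
  shows "v (poly B x) = v x ^ q ^ m"
proof -
  have less: "v x ^ q ^ n < v x ^ q ^ m"
    using assms q_power_less[OF n_less_m] by (rule power_strict_increasing[rotated])
  have "v \<pi> < v x ^ q ^ m"
    using v_pi assms one_le_power[of "v x" "q ^ m"] by linarith
  then have "v (\<pi> - x ^ q ^ n) < v (x ^ q ^ m)"
    using less ultra[of \<pi> "- (x ^ q ^ n)"] by (auto simp: v_power)
  then show ?thesis
    using v_add_eq[of "\<pi> - x ^ q ^ n" "x ^ q ^ m"] by (simp add: poly_B v_power algebra_simps)
qed

lemma poly_B_nonzero: "poly B x \<noteq> 0"
proof -
  have "0 < v (poly B x)"
    using v_pi by (cases "v x \<le> 1") (auto simp: v_poly_B v_poly_B_outside simp del: v_pos_iff)
  then show ?thesis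
    by simp
qed

text \<open>In the unit disc the denominator has absolute value |\<pi>|, which bounds the numerator;
  outside, the higher degree of the denominator wins.\<close>

lemma v_g_le_1: "v (g x) \<le> 1"
proof (cases "v x \<le> 1")
  case True
  then show ?thesis
    using v_frob[OF True] v_pi(1) by (simp add: g_def v_divide v_poly_B poly_A)
next
  case False
  then have "v (poly A x) \<le> v x ^ q"
    using power_increasing[of 1 q "v x"] q_gt_1 unfolding poly_A
    by (intro v_diff_le) (simp_all add: v_power)
  also have "\<dots> \<le> v x ^ q ^ m"
    using False q_less_q_power_m by (intro power_increasing) simp_all
  finally have "v (poly A x) \<le> v x ^ q ^ m" .
  moreover have "x \<noteq> 0"
    using False by auto
  ultimately show ?thesis
    using False by (simp add: g_def v_divide v_poly_B_outside divide_le_eq_1)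
qed

text \<open>The variation of the denominator is of second order, so to first order \<^term>\<open>g\<close> acts
  on a residue disc like multiplication by $-1/\pi$.\<close>
lemma v_g_diff:
  assumes x: "v x \<le> 1" and y: "v y \<le> 1" and xy: "v (x - y) \<le> v \<pi>"
  shows "v (g x - g y) = v (x - y) / v \<pi>"
proof (cases "x = y")
  case False
  have dA: "v (poly A x - poly A y) = v (x - y)"
  proof -
    have "v (x ^ q - y ^ q) \<le> v \<pi> * v (x - y)"
      using x y xy by (rule v_power_q_diff)
    also have "\<dots> < v (x - y)"
      using v_pi False by simp
    finally show ?thesis
      using v_add_eq[of "x ^ q - y ^ q" "y - x"] by (simp add: poly_A v_diff_commute algebra_simps)
  qed
  have "v ((x ^ q ^ m - y ^ q ^ m) - (x ^ q ^ n - y ^ q ^ n)) \<le> v \<pi> * v (x - y)"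
    by (rule v_diff_le; rule v_power_q_power_diff) (use x y xy n_pos n_less_m in auto)
  then have dB: "v (poly B x - poly B y) \<le> v \<pi> * v (x - y)"
    by (simp add: poly_B algebra_simps)
  \<comment> \<open>In the cross-multiplied difference, the term carrying the variation of
    \<open>B\<close> is smaller by a factor |\<pi>|, so it does not affect the absolute
    value.\<close>
  have "v (poly A y * (poly B x - poly B y)) \<le> v \<pi> * (v \<pi> * v (x - y))"
    unfolding v_mult using dB v_frob[OF y] by (intro mult_mono) (simp_all add: poly_A)
  also have "\<dots> < v \<pi> * v (x - y)"
    using v_pi False by simp
  also have "\<dots> = v ((poly A x - poly A y) * poly B y)"
    by (simp add: v_mult dA v_poly_B y)
  finally have "v ((poly A x - poly A y) * poly B y + - (poly A y * (poly B x - poly B y)))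
      = v ((poly A x - poly A y) * poly B y)"
    by (intro v_add_eq) simp
  also have "(poly A x - poly A y) * poly B y + - (poly A y * (poly B x - poly B y))
      = poly A x * poly B y - poly A y * poly B x"
    by (simp add: algebra_simps)
  finally have num: "v (poly A x * poly B y - poly A y * poly B x) = v (x - y) * v \<pi>"
    by (simp add: v_mult dA v_poly_B y)
  have "g x - g y = (poly A x * poly B y - poly A y * poly B x) / (poly B x * poly B y)"
    using poly_B_nonzero by (simp add: g_def diff_frac_eq)
  then show ?thesis
    using v_pi x y num by (simp add: v_divide v_mult v_poly_B)
qed simp

section \<open>Separation of orbits\<close>

text \<open>While two orbits stay within |\<pi>| of each other, each step multiplies their distance
  by 1/|\<pi>| > 1; this cannot go on forever.\<close>

lemma iterates_separate:
  assumes "v x \<le> 1" "v y \<le> 1" "x \<noteq> y"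
  shows "\<exists>k. v \<pi> < v ((g ^^ k) x - (g ^^ k) y)"
proof (rule ccontr)
  assume "\<not> ?thesis"
  then have small: "v ((g ^^ k) x - (g ^^ k) y) \<le> v \<pi>" for k
    by (simp add: not_less)
  have bound: "v ((g ^^ k) z) \<le> 1" if "v z \<le> 1" for k z
    using that v_g_le_1 by (cases k) simp_all
  have "v ((g ^^ k) x - (g ^^ k) y) = v (x - y) * (1 / v \<pi>) ^ k" for k
  proof (induction k)
    case (Suc k)
    show ?case
      using v_g_diff[of "(g ^^ k) x" "(g ^^ k) y", OF bound bound small] assms Suc.IH by simp
  qed simp
  then have "(1 / v \<pi>) ^ k \<le> v \<pi> / v (x - y)" for k
    using small[of k] assms(3) by (simp add: pos_le_divide_eq mult.commute)
  moreover obtain k where "v \<pi> / v (x - y) < (1 / v \<pi>) ^ k"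
    using real_arch_pow[of "1 / v \<pi>"] v_pi by auto
  ultimately show False
    by (meson not_less)
qed

lemma finite_fibre_g: "finite {x. g x = c}"
proof -
  \<comment> \<open>The fibre is the zero set of A - cB. For c = 0 the leading coefficient of
    \<open>A\<close> shows that this is nonzero, otherwise that of \<open>B\<close>, since q <
    q^m.\<close>
  have "coeff (A - smult c B) (if c = 0 then q else q ^ m) \<noteq> 0"
    using q_less_q_power_m q_power_less[OF n_less_m] q_gt_1 by (auto simp: coeff_A coeff_B)
  then have "A - smult c B \<noteq> 0"
    by (metis coeff_0)
  then have "finite {x. poly (A - smult c B) x = 0}"
    by (rule poly_roots_finite)
  then show ?thesis
    using poly_B_nonzero by (simp add: g_def divide_eq_eq)
qed

text \<open>The powers of \<pi> are pairwise distinct and tend to 0. They supply perturbations that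
  leave a given finite fibre.\<close>

lemma exists_small_avoiding:
  assumes "finite S" "0 < r"
  shows "\<exists>h. h \<noteq> 0 \<and> v h < r \<and> h \<notin> S"
proof -
  obtain N where N: "v \<pi> ^ N < r"
    using real_arch_pow_inv[OF assms(2) v_pi(2)] ..
  have "inj (\<lambda>k. \<pi> ^ (N + k))"
  proof (rule injI)
    fix i j assume "\<pi> ^ (N + i) = \<pi> ^ (N + j)"
    then have "v \<pi> ^ (N + i) = v \<pi> ^ (N + j)"
      by (metis v_power)
    then show "i = j"
      using v_pi power_strict_decreasing[of "N + i" "N + j" "v \<pi>"]
        power_strict_decreasing[of "N + j" "N + i" "v \<pi>"]
      by (cases i j rule: linorder_cases) auto
  qed
  then have "infinite (range (\<lambda>k. \<pi> ^ (N + k)))"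
    by (rule range_inj_infinite)
  then obtain k where k: "\<pi> ^ (N + k) \<notin> S"
    using assms(1) by (metis finite_subset image_subsetI)
  have "v \<pi> ^ (N + k) \<le> v \<pi> ^ N"
    using v_pi by (intro power_decreasing) simp_all
  with N k show ?thesis
    by (intro exI[of _ "\<pi> ^ (N + k)"]) (simp add: v_power)
qed

section \<open>The action on the projective line\<close>

definition \<Phi> :: "'a proj_line \<Rightarrow> 'a proj_line" where
  "\<Phi> = rational_map (to_fract A / to_fract B)"

lemma Phi_affine: "\<Phi> (proj_point x 1) = proj_point (g x) 1"
proof -
  have "\<Phi> (proj_point x 1) = proj_point (hom_eval (q ^ m) A x 1) (hom_eval (q ^ m) B x 1)"
    unfolding \<Phi>_def using q_less_q_power_m
    by (intro rational_map_proj_point) (simp_all add: coprime_A_B B_nonzero degree_A degree_B)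
  also have "\<dots> = proj_point (poly A x) (poly B x)"
    using q_less_q_power_m by (simp add: hom_eval_eq degree_A degree_B)
  also have "\<dots> = proj_point (g x) 1"
    using poly_B_nonzero[of x]
    by (subst proj_point_eq_iff) (auto simp: g_def intro!: exI[of _ "1 / poly B x"])
  finally show ?thesis .
qed

lemma Phi_infinity: "\<Phi> (proj_point 1 0) = proj_point 0 1"
proof -
  have "\<Phi> (proj_point 1 0) = proj_point (hom_eval (q ^ m) A 1 0) (hom_eval (q ^ m) B 1 0)"
    unfolding \<Phi>_def using q_less_q_power_m
    by (intro rational_map_proj_point) (simp_all add: coprime_A_B B_nonzero degree_A degree_B)
  \<comment> \<open>The degree of \<open>A\<close> is below the homogenization degree q^m, so its
    coefficient there vanishes.\<close>
  also have "\<dots> = proj_point 0 1"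
    using q_less_q_power_m q_power_less[OF n_less_m] q_gt_1
    by (simp add: hom_eval_0_right coeff_A coeff_B)
  finally show ?thesis .
qed

lemma Phi_iterate: "(\<Phi> ^^ k) (proj_point x 1) = proj_point ((g ^^ k) x) 1"
  by (induction k) (simp_all add: Phi_affine)

lemma dist_affine_integral:
  "v x \<le> 1 \<Longrightarrow> v y \<le> 1 \<Longrightarrow> spherical_dist v (proj_point x 1) (proj_point y 1) = v (x - y)"
  by (simp add: spherical_dist_proj_point[OF abs_val] max_absorb2)

text \<open>P and Q may lie outside the unit disc, so the first application of \<Phi> is split off;
  afterwards the orbits stay in the disc, where the spherical distance is the absolute value of the
  difference.\<close>

lemma Phi_separates:
  assumes P: "\<Phi> P = proj_point a 1" and Q: "\<Phi> Q = proj_point b 1"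
    and "v a \<le> 1" "v b \<le> 1" "a \<noteq> b"
  shows "\<exists>k. v \<pi> < spherical_dist v ((\<Phi> ^^ k) P) ((\<Phi> ^^ k) Q)"
proof -
  obtain k where k: "v \<pi> < v ((g ^^ k) a - (g ^^ k) b)"
    using iterates_separate assms by blast
  have bound: "v ((g ^^ k) z) \<le> 1" if "v z \<le> 1" for z
    using that v_g_le_1 by (cases k) simp_all
  have "v \<pi> < spherical_dist v ((\<Phi> ^^ Suc k) P) ((\<Phi> ^^ Suc k) Q)"
    using k assms bound
    by (simp add: funpow_Suc_right P Q Phi_iterate dist_affine_integral del: funpow.simps)
  then show ?thesis ..
qed

text \<open>Finite fibres provide a Q near P with a different image. The separation |\<pi>| is
  independent of P and r, which is what contradicts equicontinuity.\<close>

lemma sensitive: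
  assumes r: "0 < r"
  shows "\<exists>Q k. spherical_dist v P Q < r \<and> v \<pi> < spherical_dist v ((\<Phi> ^^ k) P) ((\<Phi> ^^ k) Q)"
proof -
  obtain x y where xy: "(x, y) \<noteq> (0, 0)" and P: "P = proj_point x y"
    by (rule proj_point_cases)
  show ?thesis
  proof (cases "y = 0")
    case False
    then have Px: "P = proj_point (x / y) 1"
      unfolding P by (subst proj_point_eq_iff) (auto intro!: exI[of _ "1 / y"])
    \<comment> \<open>Avoiding the translated fibre gives x/y and x/y + h different images.\<close>
    have "finite ((\<lambda>h. h - x / y) ` {t. g t = g (x / y)})"
      using finite_fibre_g by blast
    then obtain h where h: "h \<noteq> 0" "v h < r" "h \<notin> (\<lambda>h. h - x / y) ` {t. g t = g (x / y)}"
      using exists_small_avoiding r by blast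
    have ne: "g (x / y) \<noteq> g (x / y + h)"
      using h(3) by (force simp: image_iff)
    have "spherical_dist v P (proj_point (x / y + h) 1)
        = v h / (max (v (x / y)) 1 * max (v (x / y + h)) 1)"
      by (simp add: Px spherical_dist_proj_point[OF abs_val])
    also have "\<dots> \<le> v h / 1"
      using mult_mono[of 1 "max (v (x / y)) 1" 1 "max (v (x / y + h)) 1"]
      by (intro divide_left_mono) simp_all
    finally have "spherical_dist v P (proj_point (x / y + h) 1) < r"
      using h(2) by simp
    moreover have "\<exists>k. v \<pi> < spherical_dist v ((\<Phi> ^^ k) P) ((\<Phi> ^^ k) (proj_point (x / y + h) 1))"
      using Phi_affine Phi_affine v_g_le_1 v_g_le_1 ne unfolding Px by (rule Phi_separates)
    ultimately show ?thesis
      by blast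
  next
    case True
    then have Pinf: "P = proj_point 1 0"
      unfolding P using xy by (subst proj_point_eq_iff) (auto intro!: exI[of _ "1 / x"])
    \<comment> \<open>The neighbours of infinity are the points 1/h with h small. Since infinity
      maps to 0, 1/h must not be a zero of \<open>g\<close>.\<close>
    have "finite ((\<lambda>t. 1 / t) ` {t. g t = 0})"
      using finite_fibre_g by blast
    then obtain h where h: "h \<noteq> 0" "v h < min r 1" "h \<notin> (\<lambda>t. 1 / t) ` {t. g t = 0}"
      using exists_small_avoiding[of _ "min r 1"] r by auto
    have ne: "0 \<noteq> g (1 / h)"
      using h(1,3) by (force simp: image_iff)
    have Q: "proj_point (1 / h) 1 = proj_point 1 h"
      using h(1) by (subst proj_point_eq_iff) (auto intro!: exI[of _ h])
    have "spherical_dist v P (proj_point (1 / h) 1) = v h"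
      unfolding Pinf Q using h(2) by (simp add: spherical_dist_proj_point[OF abs_val] max_absorb1)
    then have "spherical_dist v P (proj_point (1 / h) 1) < r"
      using h(2) by simp
    moreover have "\<exists>k. v \<pi> < spherical_dist v ((\<Phi> ^^ k) P) ((\<Phi> ^^ k) (proj_point (1 / h) 1))"
      using Phi_infinity Phi_affine _ v_g_le_1 ne unfolding Pinf by (rule Phi_separates) simp
    ultimately show ?thesis
      by blast
  qed
qed

theorem Fatou_set_empty: "Fatou_set (spherical_dist v) \<Phi> = {}"
proof (rule ccontr)
  assume "Fatou_set (spherical_dist v) \<Phi> \<noteq> {}"
  then obtain P U r where r: "0 < r" "{Q. spherical_dist v P Q < r} \<subseteq> U"
    and eq: "equicontinuous_on (spherical_dist v) U (\<lambda>k. \<Phi> ^^ k)"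
    unfolding Fatou_set_def by blast
  obtain x y where "(x, y) \<noteq> (0, 0)" "P = proj_point x y"
    by (rule proj_point_cases)
  then have "spherical_dist v P P = 0"
    by (simp add: spherical_dist_proj_point[OF abs_val] mult.commute)
  then have "P \<in> U"
    using r by auto
  \<comment> \<open>Equicontinuity at P is tested with \<epsilon> = |\<pi>|; below, Q is taken
    within min(\<delta>, r) so that it also lies in \<open>U\<close>.\<close>
  then obtain \<delta> where \<delta>: "0 < \<delta>"
    "\<And>Q k. Q \<in> U \<Longrightarrow> spherical_dist v P Q < \<delta> \<Longrightarrow> spherical_dist v ((\<Phi> ^^ k) P) ((\<Phi> ^^ k) Q) < v \<pi>"
    using eq v_pi(1) unfolding equicontinuous_on_def by meson
  obtain Q k where "spherical_dist v P Q < min \<delta> r" "v \<pi> < spherical_dist v ((\<Phi> ^^ k) P) ((\<Phi> ^^ k) Q)"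
    using sensitive[of "min \<delta> r" P] \<delta>(1) r(1) by auto
  then show False
    using \<delta>(2)[of Q k] r(2) by fastforce
qed

end

section \<open>Specialization to finite extensions of the p-adic numbers\<close>

theorem theorem1p1:
  fixes p e f m n :: nat
    and absQ :: "'q::field_char_0 \<Rightarrow> real"
    and \<iota> :: "'q \<Rightarrow> 'a::field"
    and absK :: "'a \<Rightarrow> real"
    and \<pi> :: 'a
    and z \<phi> :: "'a poly fract"
  assumes "prime p"
    and "padic_numbers p absQ"
    and "finite_field_extension \<iota>"
    and "absolute_value absK" and "\<And>x. absK (\<iota> x) = absQ x"
    and "e = ramification_index p absK"
    and "f = ext_degree \<iota> div e"
    and "uniformizer p absK \<pi>"
    and "n > 0" and "m > n"
    and "z = to_fract [:0, 1:]"
    and "\<phi> = (z ^ (p ^ f) - z) / (to_fract [:\<pi>:] + z ^ (p ^ (m * f)) - z ^ (p ^ (n * f)))"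
  shows "Fatou_set (spherical_dist absK) (rational_map \<phi>) = {}"
proof -
  interpret padic_extension p absQ \<iota> absK
    using assms(1-5) by unfold_locales
  note \<pi> = uniformizer_properties[OF assms(8)]
  obtain R where R: "K.residue_system (absK \<pi>) R" and card: "card R = p ^ f"
    using residue_field_card[OF assms(8)] by (auto simp: assms(6,7))
  \<comment> \<open>With f = 0 there would be a single residue class, making 0 and 1 congruent
    modulo \<pi>.\<close>
  have f: "0 < f"
  proof (rule ccontr)
    assume "\<not> 0 < f"
    then have "card R = 1"
      using card by simp
    then obtain r where r: "R = {r}"
      by (auto simp: card_1_singleton_iff)
    have "absK (0 - r) \<le> absK \<pi>" "absK (1 - r) \<le> absK \<pi>"
      using K.residue_system_obtain[OF R, of 0] K.residue_system_obtain[OF R, of 1] by (auto simp: r)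
    then have "absK ((1 - r) - (0 - r)) \<le> absK \<pi>"
      by (rule K.v_diff_le[rotated])
    then show False
      using \<pi>(3) by simp
  qed
  interpret E: expanding_system absK \<pi> "p ^ f" m n
  proof
    show "0 < absK \<pi>"
      using assms(8) by (simp add: uniformizer_def)
    show "1 < p ^ f"
      using prime_gt_1_nat[OF assms(1)] f by (rule one_less_power)
    \<comment> \<open>As f > 0, p^f is not a unit, and every value below 1 is at most
      |\<pi>|.\<close>
    have "absK (of_nat p ^ f) < 1"
      using p_gt_1 f by (simp add: K.v_power absK_p power_one_over divide_less_eq_1 one_less_power)
    then show "absK (of_nat (p ^ f)) \<le> absK \<pi>"
      using \<pi>(4) by simp
    show "absK (x ^ p ^ f - x) \<le> absK \<pi>" if "absK x \<le> 1" for x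
      using K.v_power_card_residues[OF R \<pi>(4) \<pi>(3) that] by (simp add: card)
  qed (use \<pi> assms in auto)
  have to_fract_power: "to_fract (P ^ k) = to_fract P ^ k" for P :: "'a poly" and k
    by (induction k) simp_all
  \<comment> \<open>The exponents match because p^(m f) = (p^f)^m, and likewise for n.\<close>
  have "\<phi> = to_fract E.A / to_fract E.B"
    by (simp add: assms(11,12) E.A_def E.B_def to_fract_power power_mult[symmetric] mult.commute)
  then have "rational_map \<phi> = E.\<Phi>"
    by (simp add: E.\<Phi>_def)
  then show ?thesis
    using E.Fatou_set_empty by simp
qed

end
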